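(* Let $B\subset A$ be an inclusion of simple unital $C^*$-algebras admitting a conditional expectation $A\to B$ of finite index, let $\tau=[A:B]_0^{-1}$, and let $B\subset A=A_0\subset A_1\subset A_2\subset\cdots$ be its tower of $C^*$-basic constructions with Jones projections $e_k\in A_k$ ($k\geq1$). Then for each $k\geq0$ the algebra $B'\cap A_k$ admits a faithful tracial state $\mathrm{tr}_k$ such that, for all $k\geq1$, $$\mathrm{tr}_k(xe_k)=\tau\,\mathrm{tr}_k(x)\ \text{ for all }x\in B'\cap A_{k-1},\qquad\text{and}\qquad \mathrm{tr}_k|_{B'\cap A_{k-1}}=\mathrm{tr}_{k-1}.$$
   Context: Inclusions of unital $C^*$-algebras have common identity. A conditional expectation $E:A\to B$ is a positive norm-one projection onto $B$ with $E(axb)=aE(x)b$ for $a,b\in B$, $x\in A$. It has finite index if there is a finite set $\{\lambda_i\}\subset A$ (a quasi-basis) with $x=\sum_i\lambda_iE(\lambda_i^*x)=\sum_iE(x\lambda_i)\lambda_i^*$ for all $x\in A$; then $\mathrm{Ind}(E)=\sum_i\lambda_i\lambda_i^*$, independent of the quasi-basis. If $A,B$ are simple unital and a finite-index conditional expectation exists, all finite-index ones have scalar index and there is a unique one $E_0=E^A_B$ of minimal index; $[A:B]_0:=\mathrm{Ind}(E^A_B)$. Basic construction: $A$ is a Hilbert $B$-module with $\langle x,y\rangle_B=E_0(x^*y)$; $A$ acts by left multiplication; $e_1$ is the projection $x\mapsto E_0(x)$; $A_1$ is the $C^*$-algebra of adjointable $B$-linear maps on $A$ generated by $A$ and $e_1$.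 It is simple and unital, with minimal (dual) conditional expectation $E_1:A_1\to A$, $E_1(xe_1y)=\tau xy$ for $x,y\in A$, and $[A_1:A]_0=[A:B]_0$. Iterating, with $A_{-1}=B$, $A_0=A$, one gets the tower with minimal conditional expectations $E_k:A_k\to A_{k-1}$, where $e_k\in A_k$ is the Jones projection implementing $E_{k-1}$. *)

theory Defs
  imports "HOL-Analysis.Analysis"
begin

text \<open>
  Nonzero unital C*-algebras, the involution being \<open>star\<close>. The C*-algebras of a tower are all
  represented as unital C*-subalgebras of one such type, so that inclusions are subset
  relations. This loses no generality: the inductive limit of a tower is a unital C*-algebra
  that contains all of its members with common identity.
\<close>

class cstar_algebra = banach + real_normed_algebra_1 +
  fixes scaleC :: "complex \<Rightarrow> 'a \<Rightarrow> 'a" (infixr "*\<^sub>C" 75)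
    and star :: "'a \<Rightarrow> 'a"
  assumes scaleC_add_right: "c *\<^sub>C (x + y) = c *\<^sub>C x + c *\<^sub>C y"
    and scaleC_add_left: "(c + d) *\<^sub>C x = c *\<^sub>C x + d *\<^sub>C x"
    and scaleC_scaleC: "c *\<^sub>C (d *\<^sub>C x) = (c * d) *\<^sub>C x"
    and scaleC_of_real: "complex_of_real r *\<^sub>C x = r *\<^sub>R x"
    and mult_scaleC_left: "(c *\<^sub>C x) * y = c *\<^sub>C (x * y)"
    and mult_scaleC_right: "x * (c *\<^sub>C y) = c *\<^sub>C (x * y)"
    and norm_scaleC: "norm (c *\<^sub>C x) = cmod c * norm x"
    and star_star: "star (star x) = x"
    and star_add: "star (x + y) = star x + star y"
    and star_scaleC: "star (c *\<^sub>C x) = cnj c *\<^sub>C star x"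
    and star_mult: "star (x * y) = star y * star x"
    and cstar_identity: "norm (star x * x) = (norm x)\<^sup>2"

definition cstar_subalgebra :: "'a::cstar_algebra set \<Rightarrow> bool" where
  "cstar_subalgebra A \<longleftrightarrow>
     1 \<in> A \<and> closed A \<and>
     (\<forall>x\<in>A. \<forall>y\<in>A. x + y \<in> A \<and> x * y \<in> A) \<and>
     (\<forall>c. \<forall>x\<in>A. c *\<^sub>C x \<in> A) \<and>
     (\<forall>x\<in>A. star x \<in> A)"

definition closed_ideal :: "'a::cstar_algebra set \<Rightarrow> 'a set \<Rightarrow> bool" where
  "closed_ideal A I \<longleftrightarrow>
     I \<subseteq> A \<and> 0 \<in> I \<and> closed I \<and>
     (\<forall>x\<in>I. \<forall>y\<in>I. x + y \<in> I) \<and>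
     (\<forall>c. \<forall>x\<in>I. c *\<^sub>C x \<in> I) \<and>
     (\<forall>a\<in>A. \<forall>x\<in>I. a * x \<in> I \<and> x * a \<in> I)"

definition simple_cstar :: "'a::cstar_algebra set \<Rightarrow> bool" where
  "simple_cstar A \<longleftrightarrow> cstar_subalgebra A \<and> (\<forall>I. closed_ideal A I \<longrightarrow> I = {0} \<or> I = A)"

definition positives :: "'a::cstar_algebra set \<Rightarrow> 'a set" where
  "positives A = {star y * y | y. y \<in> A}"

definition rel_commutant :: "'a::cstar_algebra set \<Rightarrow> 'a set \<Rightarrow> 'a set" where
  "rel_commutant B A = {x \<in> A. \<forall>b\<in>B. b * x = x * b}"

text \<open>
  A conditional expectation is given by a function on the whole type of which only the values on \<open>A\<close>
  matter. Its norm is exactly one because it fixes the identity.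
\<close>

definition cond_expectation ::
    "'a::cstar_algebra set \<Rightarrow> 'a set \<Rightarrow> ('a \<Rightarrow> 'a) \<Rightarrow> bool" where
  "cond_expectation B A E \<longleftrightarrow>
     (\<forall>x\<in>A. E x \<in> B) \<and> (\<forall>b\<in>B. E b = b) \<and>
     (\<forall>x\<in>A. \<forall>y\<in>A. E (x + y) = E x + E y) \<and>
     (\<forall>c. \<forall>x\<in>A. E (c *\<^sub>C x) = c *\<^sub>C E x) \<and>
     (\<forall>x\<in>positives A. E x \<in> positives B) \<and>
     (\<forall>x\<in>A. norm (E x) \<le> norm x) \<and>
     (\<forall>a\<in>B. \<forall>b\<in>B. \<forall>x\<in>A. E (a * x * b) = a * E x * b)"

definition quasi_basis ::
    "'a::cstar_algebra set \<Rightarrow> ('a \<Rightarrow> 'a) \<Rightarrow> nat \<Rightarrow> (nat \<Rightarrow> 'a) \<Rightarrow> bool" where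
  "quasi_basis A E n l \<longleftrightarrow>
     (\<forall>i<n. l i \<in> A) \<and>
     (\<forall>x\<in>A. x = (\<Sum>i<n. l i * E (star (l i) * x)) \<and>
             x = (\<Sum>i<n. E (x * l i) * star (l i)))"

definition finite_index_expectation ::
    "'a::cstar_algebra set \<Rightarrow> 'a set \<Rightarrow> ('a \<Rightarrow> 'a) \<Rightarrow> bool" where
  "finite_index_expectation B A E \<longleftrightarrow>
     cond_expectation B A E \<and> (\<exists>n l. quasi_basis A E n l)"

text \<open>The description is unique: the sum does not depend on the quasi-basis.\<close>

definition Ind :: "'a::cstar_algebra set \<Rightarrow> ('a \<Rightarrow> 'a) \<Rightarrow> 'a" where
  "Ind A E = (THE v. \<exists>n l. quasi_basis A E n l \<and> v = (\<Sum>i<n. l i * star (l i)))"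

definition has_scalar_index ::
    "'a::cstar_algebra set \<Rightarrow> 'a set \<Rightarrow> ('a \<Rightarrow> 'a) \<Rightarrow> real \<Rightarrow> bool" where
  "has_scalar_index B A E r \<longleftrightarrow> finite_index_expectation B A E \<and> Ind A E = of_real r"

definition minimal_expectation ::
    "'a::cstar_algebra set \<Rightarrow> 'a set \<Rightarrow> ('a \<Rightarrow> 'a) \<Rightarrow> bool" where
  "minimal_expectation B A E \<longleftrightarrow>
     (\<exists>r. has_scalar_index B A E r \<and> (\<forall>F s. has_scalar_index B A F s \<longrightarrow> r \<le> s))"

definition minimal_index :: "'a::cstar_algebra set \<Rightarrow> 'a set \<Rightarrow> real" where
  "minimal_index B A = (THE r. \<exists>E. minimal_expectation B A E \<and> Ind A E = of_real r)"

text \<open>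
  \<open>A\<close> is regarded as a right Hilbert \<open>B\<close>-module with inner product \<open>E (star x * y)\<close>. Operators on
  it are elements of \<open>A \<rightarrow>\<^sub>E A\<close>, so that they are determined by their values on \<open>A\<close>.
\<close>

definition module_norm :: "('a::cstar_algebra \<Rightarrow> 'a) \<Rightarrow> 'a \<Rightarrow> real" where
  "module_norm E x = sqrt (norm (E (star x * x)))"

definition adjoint_pair ::
    "'a::cstar_algebra set \<Rightarrow> ('a \<Rightarrow> 'a) \<Rightarrow> ('a \<Rightarrow> 'a) \<Rightarrow> ('a \<Rightarrow> 'a) \<Rightarrow> bool" where
  "adjoint_pair A E T S \<longleftrightarrow>
     T \<in> A \<rightarrow>\<^sub>E A \<and> S \<in> A \<rightarrow>\<^sub>E A \<and>
     (\<forall>x\<in>A. \<forall>y\<in>A. E (star (T x) * y) = E (star x * S y))"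

definition adjointable ::
    "'a::cstar_algebra set \<Rightarrow> 'a set \<Rightarrow> ('a \<Rightarrow> 'a) \<Rightarrow> ('a \<Rightarrow> 'a) set" where
  "adjointable B A E =
     {T. (\<exists>S. adjoint_pair A E T S) \<and>
         (\<forall>x\<in>A. \<forall>y\<in>A. T (x + y) = T x + T y) \<and>
         (\<forall>c. \<forall>x\<in>A. T (c *\<^sub>C x) = c *\<^sub>C T x) \<and>
         (\<forall>x\<in>A. \<forall>b\<in>B. T (x * b) = T x * b)}"

text \<open>The last clause is closedness in the operator norm of the Hilbert module.\<close>

definition operator_cstar_algebra ::
    "'a::cstar_algebra set \<Rightarrow> 'a set \<Rightarrow> ('a \<Rightarrow> 'a) \<Rightarrow> ('a \<Rightarrow> 'a) set \<Rightarrow> bool" where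
  "operator_cstar_algebra B A E M \<longleftrightarrow>
     M \<subseteq> adjointable B A E \<and>
     (\<forall>S\<in>M. \<forall>T\<in>M. (\<lambda>x\<in>A. S x + T x) \<in> M) \<and>
     (\<forall>c. \<forall>T\<in>M. (\<lambda>x\<in>A. c *\<^sub>C T x) \<in> M) \<and>
     (\<forall>S\<in>M. \<forall>T\<in>M. compose A S T \<in> M) \<and>
     (\<forall>T\<in>M. \<forall>S. adjoint_pair A E T S \<longrightarrow> S \<in> M) \<and>
     (\<forall>T\<in>adjointable B A E.
        (\<forall>\<epsilon>>0. \<exists>S\<in>M. \<forall>x\<in>A. module_norm E (T x - S x) \<le> \<epsilon> * module_norm E x)
        \<longrightarrow> T \<in> M)"

definition left_mult :: "'a::cstar_algebra set \<Rightarrow> 'a \<Rightarrow> 'a \<Rightarrow> 'a" where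
  "left_mult A a = (\<lambda>x\<in>A. a * x)"

definition basic_construction_operators ::
    "'a::cstar_algebra set \<Rightarrow> 'a set \<Rightarrow> ('a \<Rightarrow> 'a) \<Rightarrow> ('a \<Rightarrow> 'a) set" where
  "basic_construction_operators B A E =
     \<Inter>{M. operator_cstar_algebra B A E M \<and> left_mult A ` A \<subseteq> M \<and> restrict E A \<in> M}"

text \<open>
  \<open>A1\<close>, with Jones projection \<open>e\<close>, is the basic construction of \<open>B \<subseteq> A\<close> with respect to \<open>E\<close>, with
  \<open>A\<close> identified with its image under left multiplication: there is a *-isomorphism of \<open>A1\<close>
  onto the algebra of operators above that is left multiplication on \<open>A\<close> and takes \<open>e\<close> to
  the operator \<open>E\<close>.
\<close>

definition is_basic_construction ::
    "'a::cstar_algebra set \<Rightarrow> 'a set \<Rightarrow> ('a \<Rightarrow> 'a) \<Rightarrow> 'a set \<Rightarrow> 'a \<Rightarrow> bool" where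
  "is_basic_construction B A E A1 e \<longleftrightarrow>
     cstar_subalgebra A1 \<and> A \<subseteq> A1 \<and> e \<in> A1 \<and>
     (\<exists>\<pi>. bij_betw \<pi> A1 (basic_construction_operators B A E) \<and>
        (\<forall>x\<in>A1. \<forall>y\<in>A1. \<pi> (x + y) = (\<lambda>z\<in>A. \<pi> x z + \<pi> y z)) \<and>
        (\<forall>c. \<forall>x\<in>A1. \<pi> (c *\<^sub>C x) = (\<lambda>z\<in>A. c *\<^sub>C \<pi> x z)) \<and>
        (\<forall>x\<in>A1. \<forall>y\<in>A1. \<pi> (x * y) = compose A (\<pi> x) (\<pi> y)) \<and>
        (\<forall>x\<in>A1. adjoint_pair A E (\<pi> x) (\<pi> (star x))) \<and>
        (\<forall>a\<in>A. \<pi> a = left_mult A a) \<and>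
        \<pi> e = restrict E A)"

text \<open>
  \<open>case_nat B A k\<close> is the algebra just below \<open>A k\<close>: it is \<open>B\<close> for \<open>k = 0\<close> and \<open>A (k - 1)\<close>
  otherwise. The value \<open>e 0\<close> is irrelevant.
\<close>

definition basic_construction_tower ::
    "'a::cstar_algebra set \<Rightarrow> (nat \<Rightarrow> 'a set) \<Rightarrow> (nat \<Rightarrow> 'a \<Rightarrow> 'a) \<Rightarrow> (nat \<Rightarrow> 'a) \<Rightarrow> bool" where
  "basic_construction_tower B A E e \<longleftrightarrow>
     (\<forall>k. minimal_expectation (case_nat B A k) (A k) (E k) \<and>
          is_basic_construction (case_nat B A k) (A k) (E k) (A (Suc k)) (e (Suc k)))"

definition faithful_tracial_state ::
    "'a::cstar_algebra set \<Rightarrow> ('a \<Rightarrow> complex) \<Rightarrow> bool" where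
  "faithful_tracial_state C t \<longleftrightarrow>
     (\<forall>x\<in>C. \<forall>y\<in>C. t (x + y) = t x + t y) \<and>
     (\<forall>c. \<forall>x\<in>C. t (c *\<^sub>C x) = c * t x) \<and>
     (\<forall>x\<in>positives C. t x \<in> \<real>\<^sub>\<ge>\<^sub>0) \<and>
     t 1 = 1 \<and>
     (\<forall>x\<in>positives C. t x = 0 \<longrightarrow> x = 0) \<and>
     (\<forall>x\<in>C. \<forall>y\<in>C. t (x * y) = t (y * x))"

end

theory Submission
  imports Defs
begin


text \<open>
  The trace on \<open>B' \<inter> A k\<close> is the restriction of the composite
  \<open>E 0 \<circ> E 1 \<circ> \<dots> \<circ> E k\<close>, whose values there lie in the center of \<open>B\<close>, that is, in the
  scalars. Positivity, faithfulness and compatibility with restriction are inherited from the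
  expectations. The two facts with content are that this functional is a trace and that
  \<open>E k (e k) = \<tau>\<close>. Both follow from one description of minimality.

  For an expectation \<open>E\<close> of \<open>A\<close> onto \<open>B\<close> with quasi-basis \<open>l\<close> put
  \<open>\<psi> x = (\<Sum>i<n. l i * x * star (l i))\<close>. This maps \<open>B' \<inter> A\<close> into the center of \<open>A\<close>, and
  \<open>\<psi> 1\<close> is the index. Call \<open>E\<close> standard with constant \<open>r\<close> if \<open>\<psi> = r E\<close> on \<open>B' \<inter> A\<close>.

  \<^item> A minimal \<open>E\<close> is standard (\<open>minimal_imp_standard\<close>). For \<open>h\<close> self-adjoint and invertible in
    \<open>B' \<inter> A\<close> the map \<open>x \<mapsto> E (h * x * h) / E (h * h)\<close> is again an expectation, with index
    \<open>E (h * h) \<psi> (h\<inverse> * h\<inverse>)\<close>. At \<open>h = 1 + t y\<close> with \<open>E y = 0\<close> the first order term of this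
    index is \<open>-2 t \<psi> y\<close>, so it vanishes by minimality.

  \<^item> If \<open>E\<close> is standard then \<open>E (y * z) = E (z * y)\<close> for \<open>y \<in> B' \<inter> A\<close> and \<open>z \<in> A\<close>
    (\<open>E_commute\<close>). There is a modular map \<open>\<sigma>\<close> with \<open>E (y * z) = E (z * \<sigma> y)\<close>, and \<open>\<psi>\<close> has the
    inverse modular map. If \<open>\<psi>\<close> and \<open>E\<close> are proportional then \<open>\<sigma> (\<sigma> y) = y\<close>, and since \<open>\<sigma>\<close> is a
    positive operator for the inner product of \<open>E\<close>, it is the identity.

  \<^item> The composite of standard expectations is standard, with the product of the constants
    (\<open>standard_expectation_compose\<close>), because \<open>\<psi>\<close> of the composite is the composite of the two
    maps \<open>\<psi>\<close>. Hence \<open>E 0 \<circ> \<dots> \<circ> E k\<close> is standard and its restriction is a trace.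

  \<^item> If \<open>E\<close> is standard with constant \<open>r\<close> and \<open>F\<close> is a standard expectation of the basic
    construction onto \<open>A\<close>, then \<open>F e = 1 / r\<close> and \<open>F\<close> has constant \<open>r\<close> too
    (\<open>minimal_dual_expectation\<close>). The relative commutant \<open>A' \<inter> A1\<close> consists of the right
    multiplications by \<open>B' \<inter> A\<close>, and evaluating the standard condition of \<open>F\<close> on it says that
    \<open>k = F e\<close> satisfies \<open>k\<inverse> = s r k\<close>, where \<open>s\<close> is the constant of \<open>F\<close>. As \<open>k\<close> is positive, it is a
    scalar, and \<open>1 = F 1\<close> determines which one.

  Scalar-valuedness requires trivial centers. For \<open>B\<close> and \<open>A 0\<close> these come from simplicity
  (\<open>simple_trivial_center\<close>), and each higher algebra inherits its trivial center from the algebra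
  two steps below (\<open>trivial_center_A1\<close>).

  The order structure of a C*-algebra is developed here from square roots given by the binomial
  series; the main result is that every \<open>star y * y\<close> is positive (\<open>psd_star_mult_self\<close>).
\<close>

section \<open>Involution and closed subalgebras\<close>

lemma scaleC_0_left [simp]: "0 *\<^sub>C x = (0::'a::cstar_algebra)"
  using norm_scaleC[of 0 x] by simp

lemma scaleC_0_right [simp]: "c *\<^sub>C 0 = (0::'a::cstar_algebra)"
  using norm_scaleC[of c "0::'a"] by simp

lemma scaleC_1 [simp]: "1 *\<^sub>C x = (x::'a::cstar_algebra)"
  using scaleC_of_real[of 1 x] by simp

lemma scaleC_minus_1: "(-1) *\<^sub>C x = - (x::'a::cstar_algebra)"
  using scaleC_of_real[of "-1" x] by simp

lemma scaleC_minus_left: "(- c) *\<^sub>C x = - (c *\<^sub>C (x::'a::cstar_algebra))"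
  using scaleC_scaleC[of "-1" c x] by (simp add: scaleC_minus_1)

lemma scaleC_minus_right: "c *\<^sub>C (- x) = - (c *\<^sub>C (x::'a::cstar_algebra))"
  using scaleC_scaleC[of c "-1" x] by (simp add: scaleC_minus_1 scaleC_minus_left)

lemma scaleC_diff_right: "c *\<^sub>C (x - y) = c *\<^sub>C x - c *\<^sub>C (y::'a::cstar_algebra)"
  using scaleC_add_right[of c "x - y" y] by (simp add: algebra_simps)

lemma scaleC_sum_right: "c *\<^sub>C (\<Sum>i\<in>I. f i) = (\<Sum>i\<in>I. c *\<^sub>C (f i :: 'a::cstar_algebra))"
  by (induction I rule: infinite_finite_induct) (auto simp: scaleC_add_right)

lemma star_zero [simp]: "star 0 = (0::'a::cstar_algebra)"
  using star_scaleC[of 0 "0::'a"] by simp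

lemma star_minus: "star (- x) = - star (x::'a::cstar_algebra)"
  using star_scaleC[of "-1" x] by (simp add: scaleC_minus_1)

lemma star_diff: "star (x - y) = star x - star (y::'a::cstar_algebra)"
  using star_add[of x "- y"] by (simp add: star_minus)

lemma star_one [simp]: "star 1 = (1::'a::cstar_algebra)"
  by (metis mult.right_neutral star_mult star_star)

lemma star_scaleR: "star (r *\<^sub>R x) = r *\<^sub>R star (x::'a::cstar_algebra)"
  using star_scaleC[of "complex_of_real r" x] by (simp add: scaleC_of_real)

lemma star_of_real [simp]: "star (of_real r) = (of_real r::'a::cstar_algebra)"
  by (simp add: of_real_def star_scaleR)

lemma star_sum: "star (\<Sum>i\<in>I. f i) = (\<Sum>i\<in>I. star (f i :: 'a::cstar_algebra))"
  by (induction I rule: infinite_finite_induct) (auto simp: star_add)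

lemma norm_star [simp]: "norm (star x) = norm (x::'a::cstar_algebra)"
proof -
  have le: "norm y \<le> norm (star y)" for y :: 'a
  proof (cases "y = 0")
    case False
    have "norm y * norm y \<le> norm (star y) * norm y"
      using cstar_identity[of y] norm_mult_ineq[of "star y" y] by (simp add: power2_eq_square)
    then show ?thesis using False by simp
  qed simp
  show ?thesis using le[of x] le[of "star x"] by (simp add: star_star)
qed

lemma norm_square_selfadjoint:
  "star s = s \<Longrightarrow> norm (s * s) = (norm (s::'a::cstar_algebra))\<^sup>2"
  using cstar_identity[of s] by simp

lemma star_mult_self_eq_0: "star x * x = 0 \<Longrightarrow> x = (0::'a::cstar_algebra)"
  using cstar_identity[of x] by simp

lemma bounded_linear_star: "bounded_linear (star :: 'a::cstar_algebra \<Rightarrow> 'a)"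
  by (rule bounded_linear_intro[where K = 1]) (auto simp: star_add star_scaleR)

text \<open>
  The limits of power series in \<open>x\<close> below lie in every set of this kind that contains \<open>x\<close>. Since commutants
  are such sets, this gives both membership in a C*-subalgebra and commutation. A commutant of a
  single element is usually not closed under the involution, so the involution is left out.
\<close>

definition closed_real_subalgebra :: "'a::real_normed_algebra_1 set \<Rightarrow> bool" where
  "closed_real_subalgebra S \<longleftrightarrow> closed S \<and> 1 \<in> S \<and>
     (\<forall>x\<in>S. \<forall>y\<in>S. x + y \<in> S \<and> x * y \<in> S) \<and> (\<forall>r. \<forall>x\<in>S. r *\<^sub>R x \<in> S)"

lemma closed_real_subalgebra_commutant:
  "closed_real_subalgebra {x. z * x = x * (z::'a::real_normed_algebra_1)}"
proof -
  have "closed {x. z * x = x * z}"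
    by (intro closed_Collect_eq continuous_intros)
  moreover have "z * (x * y) = x * y * z" if "z * x = x * z" "z * y = y * z" for x y
    using that by (metis mult.assoc)
  ultimately show ?thesis
    by (auto simp: closed_real_subalgebra_def algebra_simps)
qed

lemma cstar_subalgebra_closed_real: "cstar_subalgebra S \<Longrightarrow> closed_real_subalgebra S"
  unfolding cstar_subalgebra_def closed_real_subalgebra_def by (metis scaleC_of_real)

lemma closed_real_subalgebra_power:
  "closed_real_subalgebra S \<Longrightarrow> x \<in> S \<Longrightarrow> x ^ n \<in> S"
  by (induction n) (auto simp: closed_real_subalgebra_def)

lemma closed_real_subalgebra_suminf:
  assumes S: "closed_real_subalgebra S" and x: "x \<in> S" and sm: "summable (\<lambda>n. c n *\<^sub>R x ^ n)"
  shows "(\<Sum>n. c n *\<^sub>R x ^ n) \<in> S"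
proof -
  have "(\<Sum>n<m. c n *\<^sub>R x ^ n) \<in> S" for m
  proof (induction m)
    case 0
    have "0 *\<^sub>R x \<in> S" using S x unfolding closed_real_subalgebra_def by blast
    then show ?case by simp
  next
    case (Suc m)
    then show ?case using S closed_real_subalgebra_power[OF S x, of m]
      unfolding closed_real_subalgebra_def by simp
  qed
  moreover have "(\<lambda>m. \<Sum>n<m. c n *\<^sub>R x ^ n) \<longlonglongrightarrow> (\<Sum>n. c n *\<^sub>R x ^ n)"
    using sm by (rule summable_LIMSEQ)
  ultimately show ?thesis
    using S unfolding closed_real_subalgebra_def by (meson closed_sequentially)
qed

lemma neumann_inverse:
  fixes x :: "'a::{real_normed_algebra_1,banach}"
  assumes "norm x < 1"
  obtains y where "(1 - x) * y = 1" "y * (1 - x) = 1" "norm y \<le> 1 / (1 - norm x)"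
    "\<And>S. closed_real_subalgebra S \<Longrightarrow> x \<in> S \<Longrightarrow> y \<in> S"
proof
  let ?y = "\<Sum>n. x ^ n"
  have sn: "summable (\<lambda>n. norm (x ^ n))"
    by (rule summable_norm_comparison_test[of _ "\<lambda>n. norm x ^ n"])
       (auto intro!: norm_power_ineq exI[of _ 0] summable_comparison_test[of _ "\<lambda>n. norm x ^ n"]
         summable_geometric simp: assms)
  then have sm: "summable (\<lambda>n. x ^ n)" by (rule summable_norm_cancel)
  have split: "?y = 1 + (\<Sum>n. x ^ Suc n)"
    using suminf_split_head[OF sm] by simp
  have "(\<Sum>n. x ^ Suc n) = x * ?y" using suminf_mult[OF sm, of x] by simp
  then show "(1 - x) * ?y = 1" using split by (simp add: algebra_simps)
  have "(\<Sum>n. x ^ Suc n) = ?y * x"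
    using suminf_mult2[OF sm, of x] by (simp add: power_Suc2 del: power_Suc)
  then show "?y * (1 - x) = 1" using split by (simp add: algebra_simps)
  have "norm ?y \<le> (\<Sum>n. norm (x ^ n))" by (rule summable_norm[OF sn])
  also have "\<dots> \<le> (\<Sum>n. norm x ^ n)"
    by (intro suminf_le sn summable_geometric) (auto simp: norm_power_ineq assms)
  also have "\<dots> = 1 / (1 - norm x)" using suminf_geometric[of "norm x"] assms by simp
  finally show "norm ?y \<le> 1 / (1 - norm x)" .
  show "?y \<in> S" if "closed_real_subalgebra S" "x \<in> S" for S
    using closed_real_subalgebra_suminf[OF that, of "\<lambda>_. 1"] sm by simp
qed


section \<open>Square roots and positive elements\<close>

text \<open>
  The binomial series of \<open>sqrt (1 - x)\<close> converges absolutely on the closed unit ball: its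
  coefficients of positive degree are all nonpositive, and by the alternating row sum formula their
  partial sums are \<open>(-1) ^ n * (-1/2 gchoose n) - 1 \<ge> -1\<close>.
\<close>

lemma sqrt_coeffs_summable:
  shows "summable (\<lambda>n. \<bar>((1/2 :: real) gchoose n) * (-1) ^ n\<bar>)" (is "summable ?D")
    and "(\<Sum>n. \<bar>((1/2 :: real) gchoose Suc n) * (-1) ^ Suc n\<bar>) \<le> 1"
proof -
  define d where "d a n = ((a :: real) gchoose n) * (-1) ^ n" for a n
  have rec: "d a (Suc n) = d a n * ((real n - a) / (real n + 1))" for a n
  proof -
    have "(real n + 1) * (a gchoose Suc n) = (a - real n) * (a gchoose n)"
      using gbinomial_mult_1[of a n] by (simp add: algebra_simps)
    then have "a gchoose Suc n = (a - real n) * (a gchoose n) / (real n + 1)"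
      by (simp add: eq_divide_eq mult.commute)
    then show ?thesis unfolding d_def by (simp add: minus_divide_left[symmetric] algebra_simps)
  qed
  have pos: "d (-1/2) n \<ge> 0" for n
  proof (induction n)
    case (Suc n)
    then show ?case unfolding rec by (intro mult_nonneg_nonneg) auto
  qed (simp add: d_def)
  have neg: "d (1/2) (Suc n) \<le> 0" for n
  proof (induction n)
    case 0
    then show ?case by (simp add: d_def)
  next
    case (Suc n)
    then show ?case unfolding rec[of _ "Suc n"] by (intro mult_nonpos_nonneg) auto
  qed
  have bd: "(\<Sum>k<n. \<bar>d (1/2) (Suc k)\<bar>) \<le> 1" for n
  proof -
    have "(\<Sum>k\<le>n. d (1/2) k) = d (-1/2) n"
      using gbinomial_sum_lower_neg[of "1/2 :: real" n] unfolding d_def by (simp add: mult.commute)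
    moreover have "(\<Sum>k\<le>n. d (1/2) k) = 1 + (\<Sum>k<n. d (1/2) (Suc k))"
      by (simp add: sum.atMost_shift d_def)
    moreover have "(\<Sum>k<n. \<bar>d (1/2) (Suc k)\<bar>) = - (\<Sum>k<n. d (1/2) (Suc k))"
      unfolding sum_negf[symmetric] using neg by (intro sum.cong) auto
    ultimately show ?thesis using pos[of n] by simp
  qed
  then have sm: "summable (\<lambda>k. \<bar>d (1/2) (Suc k)\<bar>)"
    by (intro summableI_nonneg_bounded[where x = 1]) auto
  then show "summable ?D" unfolding d_def by (subst summable_Suc_iff[symmetric])
  show "(\<Sum>n. \<bar>((1/2 :: real) gchoose Suc n) * (-1) ^ Suc n\<bar>) \<le> 1"
    using suminf_le_const[OF sm bd] unfolding d_def .
qed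

text \<open>
  Vandermonde's identity for \<open>1/2 + 1/2 = 1\<close>: the square of the series is \<open>1 - x\<close>.
\<close>

lemma sqrt_coeffs_convolution:
  "(\<Sum>i\<le>n. (((1/2 :: real) gchoose i) * (-1) ^ i) * (((1/2) gchoose (n - i)) * (-1) ^ (n - i)))
     = (if n = 0 then 1 else if n = 1 then -1 else 0)"
proof -
  have "(\<Sum>i\<le>n. (((1/2 :: real) gchoose i) * (-1) ^ i) * (((1/2) gchoose (n - i)) * (-1) ^ (n - i)))
      = (\<Sum>i\<le>n. ((1/2) gchoose i) * ((1/2) gchoose (n - i))) * (-1) ^ n"
    unfolding sum_distrib_right
  proof (intro sum.cong refl, goal_cases)
    case (1 i)
    then have "(-1 :: real) ^ n = (-1) ^ i * (-1) ^ (n - i)" by (simp flip: power_add)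
    then show ?case by simp
  qed
  also have "\<dots> = (1 gchoose n) * (-1) ^ n"
    using gbinomial_Vandermonde[of "1/2 :: real" "1/2" n] by (simp add: atLeast0AtMost)
  also have "(1 gchoose n :: real) = of_nat (1 choose n)"
    using binomial_gbinomial[of 1 n, where 'a = real] by simp
  finally show ?thesis
    by (cases n; cases "n - 1") (auto simp: binomial_eq_0)
qed

lemma sqrt_one_minus:
  fixes x :: "'a::cstar_algebra"
  assumes sa: "star x = x" and nx: "norm x \<le> 1"
  obtains w where "star w = w" "w * w = 1 - x" "norm (1 - w) \<le> 1"
    "\<And>S. closed_real_subalgebra S \<Longrightarrow> x \<in> S \<Longrightarrow> w \<in> S"
proof
  define d where "d n = ((1/2 :: real) gchoose n) * (-1) ^ n" for n
  let ?f = "\<lambda>n. d n *\<^sub>R x ^ n"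
  let ?w = "\<Sum>n. ?f n"
  have nf: "norm (?f n) \<le> \<bar>d n\<bar>" for n
  proof -
    have "norm (x ^ n) \<le> norm x ^ n" by (rule norm_power_ineq)
    also have "\<dots> \<le> 1" using nx by (simp add: power_le_one)
    finally show ?thesis by (simp add: mult_left_le)
  qed
  have sd: "summable (\<lambda>n. \<bar>d n\<bar>)" unfolding d_def by (rule sqrt_coeffs_summable(1))
  have sn: "summable (\<lambda>n. norm (?f n))"
    by (rule summable_comparison_test[OF _ sd]) (use nf in auto)
  then have sm: "summable ?f" by (rule summable_norm_cancel)
  have "star (x ^ n) = x ^ n" for n
    by (induction n) (simp_all add: star_mult sa power_commutes)
  then show "star ?w = ?w"
    using bounded_linear.suminf[OF bounded_linear_star sm] by (simp add: star_scaleR)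
  have "(\<lambda>k. \<Sum>i\<le>k. ?f i * ?f (k - i)) sums (?w * ?w)"
    by (rule Cauchy_product_sums[OF sn sn])
  moreover have "(\<Sum>i\<le>k. ?f i * ?f (k - i)) = (if k = 0 then 1 else if k = 1 then - x else 0)" for k
  proof -
    have "(\<Sum>i\<le>k. ?f i * ?f (k - i)) = (\<Sum>i\<le>k. (d i * d (k - i)) *\<^sub>R x ^ k)"
      by (intro sum.cong) (simp_all flip: power_add)
    then show ?thesis
      using sqrt_coeffs_convolution[of k] unfolding d_def scaleR_sum_left[symmetric] by simp
  qed
  ultimately have "(\<lambda>k. if k = 0 then 1 else if k = 1 then - x else 0) sums (?w * ?w)"
    by simp
  moreover have "(\<lambda>k. if k = 0 then 1 else if k = 1 then - x else 0) sums
      (\<Sum>k\<in>{0,1::nat}. if k = 0 then 1 else if k = 1 then - x else 0)"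
    by (intro sums_finite) auto
  ultimately show "?w * ?w = 1 - x"
    using sums_unique2 by fastforce
  \<comment> \<open>The coefficient sum bounds the distance of the root to 1, which makes the root positive.\<close>
  have "?w = 1 + (\<Sum>n. ?f (Suc n))"
    using suminf_split_head[OF sm] by (simp add: d_def)
  then have "norm (1 - ?w) = norm (\<Sum>n. ?f (Suc n))" by simp
  also have "\<dots> \<le> (\<Sum>n. norm (?f (Suc n)))"
    using sn by (intro summable_norm) (subst summable_Suc_iff)
  also have "\<dots> \<le> (\<Sum>n. \<bar>d (Suc n)\<bar>)"
  proof (rule suminf_le)
    show "norm (?f (Suc n)) \<le> \<bar>d (Suc n)\<bar>" for n by (rule nf)
    show "summable (\<lambda>n. norm (?f (Suc n)))" using sn by (subst summable_Suc_iff)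
    show "summable (\<lambda>n. \<bar>d (Suc n)\<bar>)" using sd by (subst summable_Suc_iff)
  qed
  also have "\<dots> \<le> 1" unfolding d_def by (rule sqrt_coeffs_summable(2))
  finally show "norm (1 - ?w) \<le> 1" .
  show "?w \<in> S" if "closed_real_subalgebra S" "x \<in> S" for S
    using closed_real_subalgebra_suminf[OF that sm] .
qed

text \<open>
  Positive elements, described by the norm alone instead of the spectrum: the spectrum of
  \<open>a\<close> lies in \<open>[0, 2 t]\<close>. In this form the sum of positive elements is positive by the triangle
  inequality.
\<close>

definition psd :: "'a::cstar_algebra \<Rightarrow> bool" where
  "psd a \<longleftrightarrow> star a = a \<and> (\<exists>t\<ge>0. norm (of_real t - a) \<le> t)"

lemma psd_selfadjoint: "psd a \<Longrightarrow> star a = a"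
  by (simp add: psd_def)

lemma psd_sqrt:
  fixes a :: "'a::cstar_algebra"
  assumes "psd a"
  obtains s where "psd s" "star s = s" "s * s = a"
    "\<And>S. closed_real_subalgebra S \<Longrightarrow> a \<in> S \<Longrightarrow> s \<in> S"
proof -
  obtain t where t: "t \<ge> 0" "norm (of_real t - a) \<le> t" and sa: "star a = a"
    using assms unfolding psd_def by blast
  show thesis
  proof (cases "t = 0")
    case True
    then have "a = 0" using t by simp
    moreover have "psd (0::'a)" by (auto simp: psd_def)
    ultimately show thesis using that[of 0] by simp
  next
    case False
    then have tp: "t > 0" using t by simp
    define x where "x = 1 - (1/t) *\<^sub>R a"
    have x': "x = (1/t) *\<^sub>R (of_real t - a)" using tp by (simp add: x_def of_real_def algebra_simps)
    have "norm x \<le> 1" using t tp unfolding x' by simp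
    moreover have "star x = x" by (simp add: x_def star_diff star_scaleR sa)
    ultimately obtain w where w: "star w = w" "w * w = 1 - x" "norm (1 - w) \<le> 1"
      "\<And>S. closed_real_subalgebra S \<Longrightarrow> x \<in> S \<Longrightarrow> w \<in> S"
      using sqrt_one_minus by blast
    show thesis
    proof (rule that[of "sqrt t *\<^sub>R w"])
      show "star (sqrt t *\<^sub>R w) = sqrt t *\<^sub>R w" by (simp add: star_scaleR w)
      have "of_real (sqrt t) - sqrt t *\<^sub>R w = sqrt t *\<^sub>R (1 - w)"
        by (simp add: of_real_def algebra_simps)
      then have "norm (of_real (sqrt t) - sqrt t *\<^sub>R w) \<le> sqrt t"
        using w(3) tp by (simp add: mult_left_le)
      then show "psd (sqrt t *\<^sub>R w)"
        using tp unfolding psd_def by (auto simp: star_scaleR w intro!: exI[of _ "sqrt t"])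
      show "sqrt t *\<^sub>R w * (sqrt t *\<^sub>R w) = a" using tp w(2) by (simp add: x_def)
      fix S :: "'a set" assume S: "closed_real_subalgebra S" "a \<in> S"
      have "1 + (- (1/t)) *\<^sub>R a \<in> S" using S unfolding closed_real_subalgebra_def by blast
      then have "x \<in> S" by (simp add: x_def)
      then show "sqrt t *\<^sub>R w \<in> S" using w(4)[OF S(1)] S unfolding closed_real_subalgebra_def by blast
    qed
  qed
qed

lemma psd_sqrt_commute:
  fixes a :: "'a::cstar_algebra"
  assumes "psd a"
  obtains s where "psd s" "star s = s" "s * s = a" "\<And>z. z * a = a * z \<Longrightarrow> z * s = s * z"
proof -
  obtain s where s: "psd s" "star s = s" "s * s = a" "\<And>S. closed_real_subalgebra S \<Longrightarrow> a \<in> S \<Longrightarrow> s \<in> S"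
    using psd_sqrt[OF assms] by blast
  have "z * s = s * z" if "z * a = a * z" for z
    using s(4)[OF closed_real_subalgebra_commutant[of z]] that by simp
  then show thesis using that s by blast
qed

lemma imaginary_unit_square: "\<i> *\<^sub>C (\<i> *\<^sub>C x) = - (x::'a::cstar_algebra)"
  by (simp add: scaleC_scaleC scaleC_minus_1)

lemma star_mult_self_complex:
  fixes a b :: "'a::cstar_algebra"
  assumes "star a = a" "star b = b"
  shows "star (a + \<i> *\<^sub>C b) * (a + \<i> *\<^sub>C b) = a * a + b * b + \<i> *\<^sub>C (a * b - b * a)"
proof -
  have "star (a + \<i> *\<^sub>C b) = a + (- \<i>) *\<^sub>C b"
    using assms by (simp add: star_add star_scaleC)
  then have "star (a + \<i> *\<^sub>C b) = a - \<i> *\<^sub>C b" by (simp add: scaleC_minus_left)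
  then show ?thesis
    by (simp only:) (simp add: algebra_simps mult_scaleC_left mult_scaleC_right
        imaginary_unit_square scaleC_diff_right)
qed

text \<open>
  Up to the factor \<open>sqrt r\<close> the element \<open>a + \<i> b\<close> is unitary, and \<open>a\<close> is its real part.
\<close>

lemma norm_le_of_squares:
  fixes a b :: "'a::cstar_algebra"
  assumes "star a = a" "star b = b" "a * b = b * a" "a * a + b * b = of_real r" "r \<ge> 0"
  shows "norm a \<le> sqrt r"
proof -
  let ?u = "a + \<i> *\<^sub>C b"
  have "(norm ?u)\<^sup>2 = r"
    using cstar_identity[of ?u] assms star_mult_self_complex[OF assms(1,2)] by simp
  then have nu: "norm ?u = sqrt r" using assms(5) by (simp add: real_sqrt_unique)
  have "2 *\<^sub>R a = ?u + star ?u"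
    using assms by (simp add: star_add star_scaleC scaleC_minus_left scaleR_2)
  then have "2 * norm a \<le> norm ?u + norm (star ?u)"
    by (metis norm_triangle_ineq norm_scaleR abs_numeral)
  then show ?thesis using nu by simp
qed

text \<open>
  With \<open>w = sqrt (1 - s\<^sup>2 / t)\<close> the pair \<open>s / sqrt t\<close>, \<open>w\<close> has squares adding up to \<open>1\<close>, so \<open>w\<close> has
  norm at most \<open>1\<close>, and \<open>t - s\<^sup>2 = t w\<^sup>2\<close>.
\<close>

lemma norm_le_square_bound:
  fixes s :: "'a::cstar_algebra"
  assumes sa: "star s = s" and t: "(norm s)\<^sup>2 \<le> t"
  shows "norm (of_real t - s * s) \<le> t"
proof (cases "t = 0")
  case True
  then show ?thesis using t by simp
next
  case False
  then have tp: "t > 0" using t by (metis less_eq_real_def order_trans zero_le_power2)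
  define x where "x = (1/t) *\<^sub>R (s * s)"
  have "norm x \<le> 1" using tp t norm_square_selfadjoint[OF sa] by (simp add: x_def)
  moreover have "star x = x" by (simp add: x_def star_scaleR star_mult sa)
  ultimately obtain w where w: "star w = w" "w * w = 1 - x"
    "\<And>S. closed_real_subalgebra S \<Longrightarrow> x \<in> S \<Longrightarrow> w \<in> S"
    using sqrt_one_minus by blast
  have "s * w = w * s"
    using w(3)[OF closed_real_subalgebra_commutant[of s]] by (simp add: x_def mult.assoc)
  then have "norm (sqrt t *\<^sub>R w) \<le> sqrt t"
    using tp by (intro norm_le_of_squares[of _ s]) (simp_all add: star_scaleR w sa x_def algebra_simps of_real_def)
  then have "norm w \<le> 1" using tp by simp
  then have "norm (w * w) \<le> 1" using norm_square_selfadjoint[OF w(1)] by (simp add: power_le_one)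
  moreover have "of_real t - s * s = t *\<^sub>R (w * w)"
    using tp by (simp add: w x_def algebra_simps of_real_def)
  ultimately show ?thesis using tp by simp
qed

lemma psd_square: "star s = s \<Longrightarrow> psd (s * (s::'a::cstar_algebra))"
  unfolding psd_def using norm_le_square_bound[of s "(norm s)\<^sup>2"]
  by (auto simp: star_mult simp del: of_real_power intro!: exI[of _ "(norm s)\<^sup>2"])

lemma psd_norm_le:
  fixes a :: "'a::cstar_algebra"
  assumes "psd a" "norm a \<le> t"
  shows "norm (of_real t - a) \<le> t"
proof -
  obtain s where s: "star s = s" "s * s = a" using psd_sqrt[OF assms(1)] by blast
  then show ?thesis using norm_le_square_bound[of s t] norm_square_selfadjoint[of s] assms(2) by simp
qed

lemma psd_add:
  assumes "psd a" "psd b" shows "psd (a + b)"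
proof -
  obtain s t where "s \<ge> 0" "t \<ge> 0" "norm (of_real s - a) \<le> s" "norm (of_real t - b) \<le> t"
    using assms unfolding psd_def by blast
  moreover have "of_real (s + t) - (a + b) = (of_real s - a) + (of_real t - b)" by simp
  ultimately have "norm (of_real (s + t) - (a + b)) \<le> s + t"
    by (metis add_mono norm_triangle_ineq order_trans)
  then show ?thesis using assms \<open>s \<ge> 0\<close> \<open>t \<ge> 0\<close>
    unfolding psd_def by (auto simp: star_add intro!: exI[of _ "s + t"])
qed

lemma psd_0 [simp]: "psd 0"
  by (auto simp: psd_def)

lemma psd_sum: "(\<And>i. i \<in> I \<Longrightarrow> psd (f i)) \<Longrightarrow> psd (\<Sum>i\<in>I. f i)"
  by (induction I rule: infinite_finite_induct) (auto intro: psd_add)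

lemma psd_scaleR:
  assumes "psd a" "r \<ge> 0" shows "psd (r *\<^sub>R a)"
proof -
  obtain s where s: "star s = s" "s * s = a" using psd_sqrt[OF assms(1)] by blast
  then show ?thesis
    using psd_square[of "sqrt r *\<^sub>R s"] assms(2) by (simp add: star_scaleR)
qed

lemma psd_of_real: "psd (of_real r :: 'a::cstar_algebra) \<longleftrightarrow> r \<ge> 0"
proof
  assume "psd (of_real r :: 'a)"
  then obtain t where "norm (of_real (t - r) :: 'a) \<le> t" by (auto simp: psd_def)
  then show "r \<ge> 0" unfolding norm_of_real by linarith
next
  assume "r \<ge> 0" then show "psd (of_real r :: 'a)" by (auto simp: psd_def intro!: exI[of _ r])
qed

text \<open>
  Square roots of commuting elements commute, so the product is the square of their product.
\<close>

lemma psd_mult_commute: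
  assumes "psd a" "psd b" "a * b = b * a" shows "psd (a * b)"
proof -
  obtain s where s: "star s = s" "s * s = a" "\<And>z. z * a = a * z \<Longrightarrow> z * s = s * z"
    using psd_sqrt_commute[OF assms(1)] by blast
  obtain t where t: "star t = t" "t * t = b" "\<And>z. z * b = b * z \<Longrightarrow> z * t = t * z"
    using psd_sqrt_commute[OF assms(2)] by blast
  have "b * s = s * b" using s(3) assms(3) by simp
  then have st: "s * t = t * s" using t(3) by simp
  have "star (s * t) = s * t" by (simp add: star_mult s t st)
  moreover have "(s * t) * (s * t) = a * b" using st s t by (metis mult.assoc)
  ultimately show ?thesis using psd_square by metis
qed

text \<open>
  A form of closedness of the positive cone. The witness \<open>norm x + norm y\<close> in the definition of
  positivity serves all \<open>t \<le> 1\<close> at once, so the norm inequality passes to the limit.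
\<close>

lemma psd_limit:
  fixes x y :: "'a::cstar_algebra"
  assumes "star x = x" and "\<And>t. 0 < t \<Longrightarrow> t \<le> 1 \<Longrightarrow> psd (x + t *\<^sub>R y)"
  shows "psd x"
proof -
  define T where "T = norm x + norm y"
  have "norm (of_real T - x) \<le> T + \<epsilon>" if e: "\<epsilon> > 0" for \<epsilon>
  proof -
    define t where "t = min 1 (\<epsilon> / (norm y + 1))"
    have t: "0 < t" "t \<le> 1" using e by (auto simp: t_def add_nonneg_pos)
    have "t * norm y \<le> \<epsilon> / (norm y + 1) * norm y" by (intro mult_right_mono) (auto simp: t_def)
    also have "\<dots> = \<epsilon> * (norm y / (norm y + 1))" by simp
    also have "\<dots> \<le> \<epsilon> * 1"
      using e by (intro mult_left_mono) (auto simp: divide_le_eq add_nonneg_pos)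
    finally have te: "t * norm y \<le> \<epsilon>" by simp
    have "norm (x + t *\<^sub>R y) \<le> norm x + t * norm y"
      using norm_triangle_ineq[of x "t *\<^sub>R y"] t by simp
    also have "\<dots> \<le> T" unfolding T_def using t by (simp add: mult_left_le_one_le)
    finally have "norm (of_real T - (x + t *\<^sub>R y)) \<le> T" using psd_norm_le assms(2) t by blast
    moreover have "of_real T - x = (of_real T - (x + t *\<^sub>R y)) + t *\<^sub>R y" by simp
    ultimately show ?thesis
      using norm_triangle_ineq[of "of_real T - (x + t *\<^sub>R y)" "t *\<^sub>R y"] te t by simp
  qed
  then have "norm (of_real T - x) \<le> T" by (rule field_le_epsilon)
  moreover have "T \<ge> 0" by (simp add: T_def)
  ultimately show ?thesis using assms(1) unfolding psd_def by blast
qed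

text \<open>
  The product of \<open>r - x\<close> and \<open>r + x\<close> is a square \<open>q\<^sup>2\<close>, and \<open>x\<^sup>2 + q\<^sup>2 = r\<^sup>2\<close>.
\<close>

lemma norm_le_of_psd:
  fixes x :: "'a::cstar_algebra"
  assumes "psd (of_real r - x)" "psd (of_real r + x)"
  shows "norm x \<le> r"
proof -
  have "(of_real r - x) + (of_real r + x) = of_real (r + r)"
    unfolding of_real_add by simp
  then have "psd (of_real (r + r) :: 'a)" using psd_add[OF assms] by metis
  then have r: "r \<ge> 0" unfolding psd_of_real by simp
  have "star (of_real r + x) = of_real r + x" using assms psd_selfadjoint by blast
  then have sx: "star x = x" by (simp add: star_add)
  have c: "(of_real r - x) * (of_real r + x) = (of_real r + x) * (of_real r - x)"
    by (simp add: of_real_def algebra_simps)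
  have p: "psd ((of_real r - x) * (of_real r + x))"
    by (rule psd_mult_commute[OF assms c])
  have pe: "(of_real r - x) * (of_real r + x) = of_real (r * r) - x * x"
    by (simp add: of_real_def algebra_simps)
  obtain q where q: "star q = q" "q * q = of_real (r * r) - x * x"
      "\<And>z. z * (of_real (r * r) - x * x) = (of_real (r * r) - x * x) * z \<Longrightarrow> z * q = q * z"
    by (rule psd_sqrt_commute[OF p[unfolded pe]]) blast
  have "x * q = q * x"
    by (rule q(3)) (simp add: of_real_def right_diff_distrib left_diff_distrib mult.assoc)
  then have "norm x \<le> sqrt (r * r)"
    using q(2) r by (intro norm_le_of_squares[OF sx q(1)]) auto
  then show ?thesis using r by simp
qed

lemma psd_norm_minus: "star x = x \<Longrightarrow> norm x \<le> r \<Longrightarrow> psd (of_real r - x)"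
  unfolding psd_def using norm_ge_zero[of x] order_trans[OF norm_ge_zero[of x]]
  by (auto simp: star_diff intro!: exI[of _ r])

lemma psd_norm_mono:
  fixes a b :: "'a::cstar_algebra"
  assumes "psd a" "psd (b - a)"
  shows "norm a \<le> norm b"
proof (rule norm_le_of_psd)
  have b: "psd b" using psd_add[OF assms] by simp
  have "psd (of_real (norm b) - b)" by (rule psd_norm_minus) (auto simp: psd_selfadjoint b)
  from psd_add[OF this assms(2)] show "psd (of_real (norm b) - a)" by simp
  show "psd (of_real (norm b) + a)" by (intro psd_add assms) (simp add: psd_of_real)
qed

lemma psd_antisym: "psd a \<Longrightarrow> psd (- a) \<Longrightarrow> a = (0::'a::cstar_algebra)"
  using norm_le_of_psd[of 0 a] by simp

lemma psd_invertible_gap: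
  fixes b :: "'a::cstar_algebra"
  assumes "psd b" "b * y = 1" "y * b = 1"
  obtains \<delta> where "\<delta> > 0" "psd (b - of_real \<delta>)"
proof -
  have sb: "star b = b" using assms psd_selfadjoint by blast
  have "star y * b = 1" using assms(2) sb by (metis star_mult star_one)
  then have sy: "star y = y" using assms by (metis mult.assoc mult_1_left mult.right_neutral)
  define \<delta> where "\<delta> = inverse (norm y + 1)"
  have d: "\<delta> > 0" by (simp add: \<delta>_def add_nonneg_pos)
  have "norm (\<delta> *\<^sub>R y) = norm y / (norm y + 1)" by (simp add: \<delta>_def divide_inverse)
  also have "\<dots> \<le> 1" by (simp add: divide_le_eq add_nonneg_pos)
  finally have "norm (\<delta> *\<^sub>R y) \<le> 1" .
  then have "psd (of_real 1 - \<delta> *\<^sub>R y)" by (intro psd_norm_minus) (auto simp: star_scaleR sy)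
  then have "psd (b * (of_real 1 - \<delta> *\<^sub>R y))"
    by (intro psd_mult_commute assms) (simp_all add: algebra_simps assms)
  moreover have "b * (of_real 1 - \<delta> *\<^sub>R y) = b - of_real \<delta>" by (simp add: algebra_simps assms of_real_def)
  ultimately show thesis using that d by metis
qed

text \<open>
  The norm of a positive element belongs to its spectrum: if \<open>norm d - d\<close> were invertible, it would
  be at least some \<open>\<delta> > 0\<close>, whence \<open>norm d \<le> norm d - \<delta>\<close>.
\<close>

lemma norm_minus_psd_not_invertible:
  fixes d :: "'a::cstar_algebra"
  assumes "psd d" "(of_real (norm d) - d) * y = 1" "y * (of_real (norm d) - d) = 1"
  shows "d = 0"
proof (rule ccontr)
  assume "d \<noteq> 0"
  have "psd (of_real (norm d) - d)" by (intro psd_norm_minus) (auto simp: psd_selfadjoint assms)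
  then obtain \<delta> where \<delta>: "\<delta> > 0" "psd (of_real (norm d) - d - of_real \<delta>)"
    using psd_invertible_gap assms by blast
  have "psd (of_real (norm d - \<delta>) - d)" using \<delta>(2) by (simp add: algebra_simps)
  moreover from psd_add[OF psd_add[OF this assms(1)] assms(1)]
  have "psd (of_real (norm d - \<delta>) + d)" by (simp add: algebra_simps)
  ultimately have "norm d \<le> norm d - \<delta>" by (rule norm_le_of_psd)
  then show False using \<delta>(1) by simp
qed

lemma psd_plus_invertible:
  fixes p :: "'a::cstar_algebra"
  assumes "psd p" "t > 0"
  obtains y where "(of_real t + p) * y = 1" "y * (of_real t + p) = 1"
proof -
  obtain s where s: "s \<ge> 0" "norm (of_real s - p) \<le> s" using assms(1) unfolding psd_def by blast
  define u where "u = s + t"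
  have u: "u > 0" using s assms by (simp add: u_def)
  define x where "x = (1/u) *\<^sub>R (of_real s - p)"
  have "norm x \<le> s / u" using s u by (simp add: x_def divide_right_mono)
  also have "\<dots> < 1" using s(1) assms(2) by (simp add: u_def)
  finally obtain y where y: "(1 - x) * y = 1" "y * (1 - x) = 1" by (rule neumann_inverse)
  have "u *\<^sub>R x = of_real s - p" using u by (simp add: x_def)
  then have "of_real t + p = u *\<^sub>R (1 - x)"
    by (simp add: scaleR_diff_right) (simp add: u_def of_real_def scaleR_add_left)
  then show thesis using that[of "(1/u) *\<^sub>R y"] y u by simp
qed

lemma psd_inverse:
  fixes b :: "'a::cstar_algebra"
  assumes "psd b" "b * y = 1" "y * b = 1"
  shows "psd y"
proof -
  obtain s where s: "star s = s" "s * s = b" "\<And>z. z * b = b * z \<Longrightarrow> z * s = s * z"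
    using psd_sqrt_commute[OF assms(1)] by blast
  have sb: "star b = b" using assms psd_selfadjoint by blast
  have "star y * b = 1" using assms(2) sb by (metis star_mult star_one)
  then have sy: "star y = y" using assms by (metis mult.assoc mult_1_left mult.right_neutral)
  have ys: "y * s = s * y" using s(3) assms by simp
  have "(s * y) * (s * y) = y" using s(2) ys assms by (metis mult.assoc mult_1_left)
  moreover have "star (s * y) = s * y" by (simp add: star_mult s sy ys)
  ultimately show ?thesis using psd_square by metis
qed

text \<open>
  For \<open>p = \<bar>a\<bar>\<close> this is positivity of \<open>\<bar>a\<bar> - a\<close>. Perturb to \<open>X = p - a + \<epsilon>\<close> and \<open>Y = p + a + \<epsilon>\<close>. Their product is
  \<open>2 \<epsilon> p + \<epsilon>\<^sup>2\<close>, hence positive, and their sum \<open>S\<close> is positive and invertible. So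
  \<open>X = S\<inverse> (X\<^sup>2 + X Y)\<close> is a product of commuting positive elements.
\<close>

lemma psd_minus_of_square_eq:
  fixes a p :: "'a::cstar_algebra"
  assumes p: "psd p" and sa: "star a = a" and sq: "p * p = a * a" and c: "a * p = p * a"
  shows "psd (p - a)"
proof (rule psd_limit[of _ 1])
  show "star (p - a) = p - a" by (simp add: star_diff psd_selfadjoint p sa)
  fix \<epsilon> :: real assume e: "0 < \<epsilon>"
  define X where "X = p - a + \<epsilon> *\<^sub>R 1"
  define S where "S = (of_real \<epsilon> + p) + (of_real \<epsilon> + p)"
  have pS: "psd S" unfolding S_def using e by (intro psd_add p) (auto simp: psd_of_real)
  have "S = of_real (2 * \<epsilon>) + 2 *\<^sub>R p"
    by (simp only: S_def mult_2 scaleR_2 of_real_add add_ac)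
  then obtain y where y: "S * y = 1" "y * S = 1"
    using psd_plus_invertible[of "2 *\<^sub>R p" "2 * \<epsilon>"] psd_scaleR[OF p, of 2] e by auto
  have py: "psd y" using psd_inverse pS y by blast
  have sX: "star X = X" by (simp add: X_def star_add star_diff star_scaleR psd_selfadjoint p sa)
  have XS: "X * S = X * X + (\<epsilon> *\<^sub>R p + \<epsilon> *\<^sub>R p + of_real (\<epsilon> * \<epsilon>))"
    by (simp add: X_def S_def of_real_def algebra_simps sq c)
  have SX: "S * X = X * S"
    by (simp add: X_def S_def of_real_def algebra_simps c)
  have pXS: "psd (X * S)" unfolding XS
    using e by (intro psd_add psd_square sX psd_scaleR p) (auto simp: psd_of_real simp del: of_real_mult)
  have Xy: "y * X = X * y" using SX y by (metis mult.assoc mult_1_left mult.right_neutral)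
  have "psd (y * (X * S))"
  proof (rule psd_mult_commute[OF py pXS])
    show "y * (X * S) = X * S * y" using Xy y by (metis mult.assoc mult_1_left mult.right_neutral)
  qed
  moreover have "y * (X * S) = X" using Xy y by (metis mult.assoc mult.right_neutral)
  ultimately show "psd (p - a + \<epsilon> *\<^sub>R 1)" by (simp add: X_def)
qed

lemma complex_decomposition:
  fixes x :: "'a::cstar_algebra"
  obtains a b where "star a = a" "star b = b" "x = a + \<i> *\<^sub>C b"
    "a = (1/2) *\<^sub>R (x + star x)" "b = (-\<i>/2) *\<^sub>C (x - star x)"
proof -
  define a where "a = (1/2) *\<^sub>R (x + star x)"
  define b where "b = (-\<i>/2) *\<^sub>C (x - star x)"
  have "star a = a" by (simp add: a_def star_scaleR star_add star_star add.commute)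
  moreover have "star b = b"
  proof -
    have "star b = (\<i>/2) *\<^sub>C (- (x - star x))" by (simp add: b_def star_scaleC star_diff star_star)
    also have "\<dots> = b" unfolding scaleC_minus_right b_def
      using scaleC_minus_left[of "\<i>/2" "x - star x"] by simp
    finally show ?thesis .
  qed
  moreover have "x = a + \<i> *\<^sub>C b"
  proof -
    have "\<i> *\<^sub>C b = complex_of_real (1/2) *\<^sub>C (x - star x)" by (simp add: b_def scaleC_scaleC)
    then have "\<i> *\<^sub>C b = (1/2) *\<^sub>R (x - star x)" by (simp only: scaleC_of_real)
    then show ?thesis by (simp add: a_def flip: scaleR_add_right)
  qed
  ultimately show thesis using that a_def b_def by blast
qed

text \<open>
  Write \<open>c = a + \<i> b\<close>. Since \<open>star c * c + c * star c = 2 (a\<^sup>2 + b\<^sup>2)\<close> is positive, \<open>c * star c\<close> is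
  positive together with \<open>d = - (star c * c)\<close>. But \<open>star c * c\<close> and \<open>c * star c\<close> have the same nonzero
  spectrum, so \<open>t - d = t + star c * c\<close> is invertible for all \<open>t > 0\<close>, in particular for
  \<open>t = norm d\<close>.
\<close>

lemma star_mult_self_nonpos_imp_0:
  fixes c :: "'a::cstar_algebra"
  assumes "psd (- (star c * c))"
  shows "c = 0"
proof -
  define d where "d = - (star c * c)"
  obtain a b where ab: "star a = a" "star b = b" "c = a + \<i> *\<^sub>C b" by (rule complex_decomposition)
  have sc: "star c = a + \<i> *\<^sub>C (- b)"
    using ab by (simp add: star_add star_scaleC scaleC_minus_left scaleC_minus_right)
  have 1: "star c * c = a * a + b * b + \<i> *\<^sub>C (a * b - b * a)"
    unfolding ab(3) by (rule star_mult_self_complex[OF ab(1,2)])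
  have "c * star c = star (star c) * star c" by (simp add: star_star)
  also have "\<dots> = a * a + (-b) * (-b) + \<i> *\<^sub>C (a * (-b) - (-b) * a)"
    unfolding sc using ab by (intro star_mult_self_complex) (auto simp: star_minus)
  also have "\<dots> = a * a + b * b + \<i> *\<^sub>C (- (a * b - b * a))" by simp
  also have "\<i> *\<^sub>C (- (a * b - b * a)) = - (\<i> *\<^sub>C (a * b - b * a))"
    by (rule scaleC_minus_right)
  finally have sum: "c * star c = 2 *\<^sub>R (a * a + b * b) + d" unfolding d_def 1 by (simp add: scaleR_2)
  have dd: "psd d" using assms by (simp add: d_def)
  have pc: "psd (c * star c)"
    unfolding sum by (intro psd_add psd_scaleR psd_square dd ab) auto
  show "c = 0"
  proof (rule ccontr)
    assume c0: "c \<noteq> 0"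
    then have "d \<noteq> 0" unfolding d_def using star_mult_self_eq_0[of c] by auto
    define t where "t = norm d"
    have t: "t > 0" using \<open>d \<noteq> 0\<close> by (simp add: t_def)
    obtain y where y: "(of_real t + c * star c) * y = 1" "y * (of_real t + c * star c) = 1"
      using psd_plus_invertible[OF pc t] by blast
    \<comment> \<open>The formula turning an inverse of \<open>t + c * star c\<close> into one of \<open>t + star c * c\<close>.\<close>
    define z where "z = (1/t) *\<^sub>R (1 - star c * y * c)"
    have tz: "of_real t - d = of_real t + star c * c" by (simp add: d_def)
    have y1: "c * (star c * y) = 1 - t *\<^sub>R y"
      using y(1) by (simp add: algebra_simps of_real_def mult.assoc)
    have y2: "y * (c * star c) = 1 - t *\<^sub>R y"
      using y(2) by (simp add: algebra_simps of_real_def)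
    have "star c * c * (star c * y * c) = star c * (c * (star c * y)) * c" by (simp add: mult.assoc)
    then have e1: "star c * c * (star c * y * c) = star c * c - t *\<^sub>R (star c * y * c)"
      unfolding y1 by (simp add: algebra_simps)
    have "star c * y * c * (star c * c) = star c * (y * (c * star c)) * c" by (simp add: mult.assoc)
    then have e2: "star c * y * c * (star c * c) = star c * c - t *\<^sub>R (star c * y * c)"
      unfolding y2 by (simp add: algebra_simps)
    have "(of_real t - d) * (t *\<^sub>R z) = t *\<^sub>R 1"
      unfolding tz using t e1 by (simp add: z_def algebra_simps of_real_def)
    then have z1: "(of_real t - d) * z = 1" using t by simp
    have "(t *\<^sub>R z) * (of_real t - d) = t *\<^sub>R 1"
      unfolding tz using t e2 by (simp add: z_def algebra_simps of_real_def)
    then have z2: "z * (of_real t - d) = 1" using t by simp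
    show False using norm_minus_psd_not_invertible[OF dd] z1 z2 \<open>d \<noteq> 0\<close> unfolding t_def by blast
  qed
qed

text \<open>
  The argument of Fukamiya and Kaplansky. Let \<open>q\<close> be twice the negative part of \<open>a = star y * y\<close>. Then
  \<open>star (y * q) * (y * q) = q a q = - q\<^sup>3 / 2\<close> is negative, so \<open>y * q = 0\<close> by the preceding lemma and
  \<open>q = 0\<close>.
\<close>

theorem psd_star_mult_self:
  fixes y :: "'a::cstar_algebra"
  shows "psd (star y * y)"
proof -
  define a where "a = star y * y"
  have sa: "star a = a" by (simp add: a_def star_mult star_star)
  obtain p where p: "psd p" "p * p = a * a" "a * p = p * a"
  proof -
    obtain p where "psd p" "p * p = a * a" "\<And>z. z * (a * a) = a * a * z \<Longrightarrow> z * p = p * z"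
      using psd_sqrt_commute[OF psd_square[OF sa]] by blast
    then show thesis using that by (simp add: mult.assoc)
  qed
  define q where "q = p - a"
  have pq: "psd q" unfolding q_def by (rule psd_minus_of_square_eq[OF p(1) sa p(2,3)])
  have sq: "star q = q" using pq psd_selfadjoint by blast
  have qa: "q * a = - ((1/2) *\<^sub>R (q * q))"
  proof -
    have "2 *\<^sub>R (q * a) = - (q * q)"
      by (simp add: q_def algebra_simps p scaleR_2)
    then show ?thesis by (metis scaleR_minus_right scaleR_half_double scaleR_2 scaleR_add_right)
  qed
  have "star (y * q) * (y * q) = q * a * q" by (simp add: star_mult sq a_def mult.assoc)
  also have "\<dots> = - ((1/2) *\<^sub>R (q * q * q))" unfolding qa by simp
  finally have e: "star (y * q) * (y * q) = - ((1/2) *\<^sub>R (q * q * q))" .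
  have "psd (q * q * q)" by (intro psd_mult_commute pq psd_square sq) (simp add: mult.assoc)
  then have "psd (- (star (y * q) * (y * q)))" unfolding e by (simp add: psd_scaleR)
  then have "y * q = 0" by (rule star_mult_self_nonpos_imp_0)
  then have "q * q * q = 0" using e by simp
  then have "(q * q) * (q * q) = 0" by (metis mult.assoc mult_zero_left)
  then have "q * q = 0" using star_mult_self_eq_0[of "q * q"] by (simp add: star_mult sq)
  then have "q = 0" using star_mult_self_eq_0[of q] by (simp add: sq)
  then have "a = p" by (simp add: q_def)
  then show ?thesis using p(1) by (simp add: a_def)
qed


section \<open>Simple algebras have trivial center\<close>

lemma
  assumes "cstar_subalgebra C"
  shows subalgebra_1: "1 \<in> C"
    and subalgebra_add: "x \<in> C \<Longrightarrow> y \<in> C \<Longrightarrow> x + y \<in> C"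
    and subalgebra_mult: "x \<in> C \<Longrightarrow> y \<in> C \<Longrightarrow> x * y \<in> C"
    and subalgebra_scaleC: "x \<in> C \<Longrightarrow> c *\<^sub>C x \<in> C"
    and subalgebra_star: "x \<in> C \<Longrightarrow> star x \<in> C"
    and subalgebra_closed: "closed C"
  using assms unfolding cstar_subalgebra_def by auto

lemma subalgebra_scaleR: "cstar_subalgebra C \<Longrightarrow> x \<in> C \<Longrightarrow> r *\<^sub>R x \<in> C"
  by (metis subalgebra_scaleC scaleC_of_real)

lemma subalgebra_0: "cstar_subalgebra C \<Longrightarrow> 0 \<in> C"
  by (metis subalgebra_scaleC subalgebra_1 scaleC_0_left)

lemma subalgebra_minus: "cstar_subalgebra C \<Longrightarrow> x \<in> C \<Longrightarrow> - x \<in> C"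
  by (metis subalgebra_scaleC scaleC_minus_1)

lemma subalgebra_diff: "cstar_subalgebra C \<Longrightarrow> x \<in> C \<Longrightarrow> y \<in> C \<Longrightarrow> x - y \<in> C"
  using subalgebra_add[of C x "- y"] subalgebra_minus[of C y] by simp

lemma subalgebra_of_real: "cstar_subalgebra C \<Longrightarrow> of_real r \<in> C"
  unfolding of_real_def by (intro subalgebra_scaleR subalgebra_1)

lemma subalgebra_sum: "cstar_subalgebra C \<Longrightarrow> (\<And>i. i \<in> I \<Longrightarrow> f i \<in> C) \<Longrightarrow> (\<Sum>i\<in>I. f i) \<in> C"
  by (induction I rule: infinite_finite_induct) (auto intro: subalgebra_0 subalgebra_add)

lemmas subalgebra_intros = subalgebra_1 subalgebra_0 subalgebra_add subalgebra_diff subalgebra_minus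
  subalgebra_mult subalgebra_scaleC subalgebra_scaleR subalgebra_star subalgebra_of_real subalgebra_sum

lemma cstar_subalgebra_rel_commutant:
  assumes A: "cstar_subalgebra A" and B: "\<And>b. b \<in> B \<Longrightarrow> star b \<in> B"
  shows "cstar_subalgebra (rel_commutant B A)"
  unfolding cstar_subalgebra_def
proof (intro conjI ballI allI)
  have "rel_commutant B A = A \<inter> (\<Inter>b\<in>B. {x. b * x = x * b})"
    by (auto simp: rel_commutant_def)
  moreover have "closed {x. b * x = x * b}" for b :: 'a
    by (intro closed_Collect_eq continuous_intros)
  ultimately show "closed (rel_commutant B A)"
    using subalgebra_closed[OF A] by (auto intro!: closed_Int closed_INT)
  show "1 \<in> rel_commutant B A" using A by (auto simp: rel_commutant_def subalgebra_1)
next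
  fix x y assume "x \<in> rel_commutant B A" "y \<in> rel_commutant B A"
  then have xy: "x \<in> A" "y \<in> A" and c: "\<And>b. b \<in> B \<Longrightarrow> b * x = x * b" "\<And>b. b \<in> B \<Longrightarrow> b * y = y * b"
    by (auto simp: rel_commutant_def)
  show "x + y \<in> rel_commutant B A"
    using xy c by (auto simp: rel_commutant_def algebra_simps intro: subalgebra_intros A)
  have "b * (x * y) = x * y * b" if "b \<in> B" for b using c[OF that] by (metis mult.assoc)
  then show "x * y \<in> rel_commutant B A"
    using xy by (auto simp: rel_commutant_def intro: subalgebra_intros A)
next
  fix x c assume "x \<in> rel_commutant B A"
  then show "c *\<^sub>C x \<in> rel_commutant B A"
    by (auto simp: rel_commutant_def mult_scaleC_left mult_scaleC_right intro: subalgebra_intros A)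
next
  fix x assume x: "x \<in> rel_commutant B A"
  have "b * star x = star x * b" if "b \<in> B" for b
  proof -
    have "star b * x = x * star b" using x B[OF that] by (auto simp: rel_commutant_def)
    then have "star (star b * x) = star (x * star b)" by simp
    then show ?thesis by (simp add: star_mult star_star)
  qed
  then show "star x \<in> rel_commutant B A"
    using x by (auto simp: rel_commutant_def intro: subalgebra_intros A)
qed

lemma of_real_conv_scaleC: "(of_real r :: 'a::cstar_algebra) = complex_of_real r *\<^sub>C 1"
  by (subst scaleC_of_real) (rule of_real_def)

definition trivial_center :: "'a::cstar_algebra set \<Rightarrow> bool" where
  "trivial_center C \<longleftrightarrow> (\<forall>z\<in>C. (\<forall>x\<in>C. z * x = x * z) \<longrightarrow> (\<exists>c. z = c *\<^sub>C 1))"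

lemma closure_closed_under:
  assumes uv: "u \<in> closure S" "v \<in> closure S" and S: "\<And>a b. a \<in> S \<Longrightarrow> b \<in> S \<Longrightarrow> f a b \<in> S"
    and cont: "\<And>X Y. X \<longlonglongrightarrow> u \<Longrightarrow> Y \<longlonglongrightarrow> v \<Longrightarrow> (\<lambda>n. f (X n) (Y n)) \<longlonglongrightarrow> f u v"
  shows "f u v \<in> closure (S :: 'a::metric_space set)"
proof -
  obtain X Y where X: "\<And>n. X n \<in> S" "X \<longlonglongrightarrow> u" and Y: "\<And>n. Y n \<in> S" "Y \<longlonglongrightarrow> v"
    using uv unfolding closure_sequential by blast
  have "f (X n) (Y n) \<in> S" for n using S X(1) Y(1) .
  then show ?thesis using cont[OF X(2) Y(2)] unfolding closure_sequential
    by (intro exI[of _ "\<lambda>n. f (X n) (Y n)"]) simp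
qed

lemma closed_ideal_closure_central_multiples:
  assumes C: "cstar_subalgebra C" and x: "x \<in> C" and central: "\<And>a. a \<in> C \<Longrightarrow> x * a = a * x"
  shows "closed_ideal C (closure ((*) x ` C))" (is "closed_ideal C ?I")
proof -
  have sub: "(*) x ` C \<subseteq> C" using C x by (auto intro: subalgebra_intros)
  show ?thesis unfolding closed_ideal_def
  proof (intro conjI ballI allI)
    show "?I \<subseteq> C" by (rule closure_minimal[OF sub subalgebra_closed[OF C]])
    have "x * 0 \<in> (*) x ` C" using subalgebra_0[OF C] by (rule imageI)
    then show "0 \<in> ?I" using closure_subset[of "(*) x ` C"] by auto
    show "closed ?I" by simp
    fix u assume u: "u \<in> ?I"
    show "u + v \<in> ?I" if v: "v \<in> ?I" for v
    proof (rule closure_closed_under[where f = "(+)", OF u v])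
      show "a + b \<in> (*) x ` C" if ab: "a \<in> (*) x ` C" "b \<in> (*) x ` C" for a b
      proof -
        obtain c d where "c \<in> C" "d \<in> C" "a = x * c" "b = x * d" using ab by blast
        then have "c + d \<in> C" "a + b = x * (c + d)"
          using subalgebra_add[OF C] by (simp_all add: distrib_left)
        then show ?thesis by blast
      qed
    qed (rule tendsto_add)
    show "c *\<^sub>C u \<in> ?I" for c
    proof (rule closure_closed_under[where f = "\<lambda>w _. c *\<^sub>C w", OF u u])
      show "c *\<^sub>C a \<in> (*) x ` C" if "a \<in> (*) x ` C" for a
        using that subalgebra_scaleC[OF C] by (auto simp flip: mult_scaleC_right)
      show "(\<lambda>n. c *\<^sub>C X n) \<longlonglongrightarrow> c *\<^sub>C u" if "X \<longlonglongrightarrow> u" for X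
        using tendsto_mult_left[OF that, of "c *\<^sub>C 1"] by (simp add: mult_scaleC_left)
    qed
    fix a assume a: "a \<in> C"
    show "a * u \<in> ?I"
    proof (rule closure_closed_under[where f = "\<lambda>w _. a * w", OF u u])
      show "a * b \<in> (*) x ` C" if b: "b \<in> (*) x ` C" for b
      proof -
        obtain d where "d \<in> C" "b = x * d" using b by blast
        then have "a * d \<in> C" "a * b = x * (a * d)"
          using subalgebra_mult[OF C a] central[OF a] by (simp_all add: mult.assoc[symmetric])
        then show ?thesis by blast
      qed
    qed (rule tendsto_mult_left)
    show "u * a \<in> ?I"
    proof (rule closure_closed_under[where f = "\<lambda>w _. w * a", OF u u])
      show "b * a \<in> (*) x ` C" if "b \<in> (*) x ` C" for b
        using that subalgebra_mult[OF C _ a] by (auto simp: mult.assoc)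
    qed (rule tendsto_mult_right)
  qed
qed

text \<open>
  The closure of the multiples of \<open>x\<close> is a nonzero closed ideal, hence contains \<open>1\<close>, and a multiple
  of \<open>x\<close> close to \<open>1\<close> is invertible.
\<close>

lemma simple_central_invertible:
  assumes C: "simple_cstar C" and x: "x \<in> C" and central: "\<And>a. a \<in> C \<Longrightarrow> x * a = a * x" and "x \<noteq> 0"
  obtains y where "y \<in> C" "x * y = 1"
proof -
  have sC: "cstar_subalgebra C" using C by (simp add: simple_cstar_def)
  let ?I = "closure ((*) x ` C)"
  have "closed_ideal C ?I" using closed_ideal_closure_central_multiples[OF sC x central] .
  moreover have "x * 1 \<in> ?I"
    using subalgebra_1[OF sC] closure_subset[of "(*) x ` C"] by blast
  ultimately have "?I = C" using C \<open>x \<noteq> 0\<close> unfolding simple_cstar_def by auto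
  then have "1 \<in> ?I" using subalgebra_1[OF sC] by simp
  then obtain w where "w \<in> (*) x ` C" "dist w 1 < 1"
    unfolding closure_approachable using zero_less_one by blast
  then obtain c where c: "c \<in> C" "norm (1 - x * c) < 1"
    by (auto simp: dist_norm norm_minus_commute)
  obtain y where y: "(1 - (1 - x * c)) * y = 1"
      "\<And>S. closed_real_subalgebra S \<Longrightarrow> 1 - x * c \<in> S \<Longrightarrow> y \<in> S"
    using neumann_inverse[OF c(2)] by metis
  have "y \<in> C"
    by (rule y(2)[OF cstar_subalgebra_closed_real[OF sC]]) (intro subalgebra_intros sC x c)
  then show thesis using that[of "c * y"] y(1) c(1) sC by (auto simp: mult.assoc intro: subalgebra_intros)
qed

text \<open>
  For central self-adjoint \<open>a\<close> the product of \<open>norm a - a\<close> and \<open>norm a + a\<close> is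
  \<open>norm (a\<^sup>2) - a\<^sup>2\<close>, which is not invertible unless \<open>a = 0\<close>. So one factor is a noninvertible central
  element, hence zero. So either \<open>norm a\<close> or \<open>- norm a\<close>
  serves as the spectral value that the Gelfand--Mazur theorem would provide.
\<close>

theorem simple_trivial_center:
  assumes C: "simple_cstar C" shows "trivial_center C"
proof -
  have sC: "cstar_subalgebra C" using C by (simp add: simple_cstar_def)
  have scalar: "\<exists>r. a = of_real r"
    if a: "a \<in> C" "star a = a" and central: "\<And>x. x \<in> C \<Longrightarrow> a * x = x * a" for a
  proof (cases "of_real (norm a) - a = 0 \<or> of_real (norm a) + a = 0")
    case True
    then have "a = of_real (norm a) \<or> a = of_real (- norm a)"
      by (auto simp: add_eq_0_iff2 minus_equation_iff)
    then show ?thesis by blast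
  next
    case False
    let ?p = "of_real (norm a) - a" and ?q = "of_real (norm a) + a"
    have cp: "?p * x = x * ?p" and cq: "?q * x = x * ?q" if "x \<in> C" for x
      using central[OF that] by (simp_all add: of_real_def algebra_simps)
    have p: "?p \<in> C" "?p \<noteq> 0" and q: "?q \<in> C" "?q \<noteq> 0"
      using False a(1) by (auto intro!: subalgebra_intros sC)
    obtain u where u: "u \<in> C" "?p * u = 1"
      using simple_central_invertible[OF C p(1) cp p(2)] by blast
    obtain v where v: "v \<in> C" "?q * v = 1"
      using simple_central_invertible[OF C q(1) cq q(2)] by blast
    have d: "of_real (norm (a * a)) - a * a = ?p * ?q"
      using norm_square_selfadjoint[OF a(2)] by (simp add: of_real_def algebra_simps power2_eq_square)
    have "?p * ?q * (v * u) = ?p * (?q * v) * u" by (simp add: mult.assoc)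
    then have r: "?p * ?q * (v * u) = 1" using u v by simp
    have vu: "v * u \<in> C" using u v by (intro subalgebra_mult sC)
    have "?p * ?q * (v * u) = ?p * (v * u * ?q)" unfolding mult.assoc cq[OF vu, unfolded mult.assoc] ..
    also have "\<dots> = v * u * (?p * ?q)" using cp[OF vu] by (simp only: mult.assoc[symmetric])
    finally have c: "?p * ?q * (v * u) = v * u * (?p * ?q)" .
    then have "a * a = 0"
      using norm_minus_psd_not_invertible[OF psd_square[OF a(2)], of "v * u", unfolded d, OF r] r c by simp
    then have "a = of_real 0" using star_mult_self_eq_0[of a] a(2) by simp
    then show ?thesis by blast
  qed
  show ?thesis unfolding trivial_center_def
  proof (intro ballI impI)
    fix z assume z: "z \<in> C" and cz: "\<forall>x\<in>C. z * x = x * z"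
    have csz: "star z * x = x * star z" if "x \<in> C" for x
    proof -
      have "star (z * star x) = star (star x * z)" using cz subalgebra_star[OF sC that] by simp
      then show ?thesis by (simp add: star_mult star_star)
    qed
    obtain a b where ab: "star a = a" "star b = b" "z = a + \<i> *\<^sub>C b"
      "a = (1/2) *\<^sub>R (z + star z)" "b = (-\<i>/2) *\<^sub>C (z - star z)"
      by (rule complex_decomposition)
    have A: "a \<in> C" "b \<in> C" unfolding ab(4,5) by (intro subalgebra_intros sC z)+
    have "a * x = x * a" if "x \<in> C" for x
      using bspec[OF cz that] csz[OF that] by (simp add: ab(4) distrib_left distrib_right)
    then have "\<exists>r. a = of_real r" by (rule scalar[OF A(1) ab(1)])
    moreover have "b * x = x * b" if "x \<in> C" for x
      using bspec[OF cz that] csz[OF that]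
      by (simp add: ab(5) left_diff_distrib right_diff_distrib mult_scaleC_left mult_scaleC_right)
    then have "\<exists>r. b = of_real r" by (rule scalar[OF A(2) ab(2)])
    ultimately obtain r s where "z = of_real r + \<i> *\<^sub>C of_real s" using ab(3) by blast
    then have "z = complex_of_real r *\<^sub>C 1 + \<i> *\<^sub>C (complex_of_real s *\<^sub>C 1)"
      by (simp only: of_real_conv_scaleC)
    then have "z = (complex_of_real r + \<i> * complex_of_real s) *\<^sub>C 1"
      by (simp add: scaleC_scaleC scaleC_add_left)
    then show "\<exists>c. z = c *\<^sub>C 1" by blast
  qed
qed


section \<open>Conditional expectations\<close>

lemma rel_commutant_commutes: "x \<in> rel_commutant B A \<Longrightarrow> b \<in> B \<Longrightarrow> b * x = x * b"
  by (simp add: rel_commutant_def)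

lemma selfadjoint_scalar:
  assumes "star (c *\<^sub>C 1) = (c *\<^sub>C 1 :: 'a::cstar_algebra)"
  shows "c *\<^sub>C 1 = (of_real (Re c) :: 'a)"
proof -
  have "cnj c *\<^sub>C (1::'a) = c *\<^sub>C 1" using assms by (simp add: star_scaleC)
  then have "(cnj c - c) *\<^sub>C (1::'a) = 0"
    using scaleC_add_left[of "cnj c" "- c" "1::'a"] by (simp add: scaleC_minus_left)
  then have "cmod (cnj c - c) = 0" by (metis norm_scaleC norm_zero norm_one mult.right_neutral)
  then have "Im c = 0" by (simp add: complex_eq_iff)
  then have "c = complex_of_real (Re c)" by (simp add: complex_eq_iff)
  then show ?thesis by (metis scaleC_of_real of_real_def)
qed

lemma positives_psd: "x \<in> positives A \<Longrightarrow> psd x"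
  by (auto simp: positives_def psd_star_mult_self)

text \<open>
  The axioms of a conditional expectation except contractivity, which is derived from them by the
  Kadison--Schwarz inequality. So a map that is constructed later need only satisfy these.
\<close>

locale positive_projection =
  fixes B A :: "'a::cstar_algebra set" and E :: "'a \<Rightarrow> 'a"
  assumes subalgebra_B: "cstar_subalgebra B" and subalgebra_A: "cstar_subalgebra A" and B_subset: "B \<subseteq> A"
    and E_in: "x \<in> A \<Longrightarrow> E x \<in> B"
    and E_fix: "b \<in> B \<Longrightarrow> E b = b"
    and E_add: "x \<in> A \<Longrightarrow> y \<in> A \<Longrightarrow> E (x + y) = E x + E y"
    and E_scaleC: "x \<in> A \<Longrightarrow> E (c *\<^sub>C x) = c *\<^sub>C E x"
    and E_positive: "x \<in> positives A \<Longrightarrow> E x \<in> positives B"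
    and E_bimodule: "a \<in> B \<Longrightarrow> b \<in> B \<Longrightarrow> x \<in> A \<Longrightarrow> E (a * x * b) = a * E x * b"
begin

lemmas inA = subalgebra_intros[OF subalgebra_A]
lemmas inB = subalgebra_intros[OF subalgebra_B]

lemma B_A: "b \<in> B \<Longrightarrow> b \<in> A"
  using B_subset by blast

lemma E_A: "x \<in> A \<Longrightarrow> E x \<in> A"
  using E_in B_subset by blast

lemma E_left: "b \<in> B \<Longrightarrow> x \<in> A \<Longrightarrow> E (b * x) = b * E x"
  using E_bimodule[of b 1 x] by (simp add: inB)

lemma E_right: "b \<in> B \<Longrightarrow> x \<in> A \<Longrightarrow> E (x * b) = E x * b"
  using E_bimodule[of 1 b x] by (simp add: inB)

lemma E_0 [simp]: "E 0 = 0" by (simp add: E_fix inB)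
lemma E_1 [simp]: "E 1 = 1" by (simp add: E_fix inB)
lemma E_of_real [simp]: "E (of_real r) = of_real r" by (simp add: E_fix inB)

lemma E_scaleR: "x \<in> A \<Longrightarrow> E (r *\<^sub>R x) = r *\<^sub>R E x"
  using E_scaleC[of x "complex_of_real r"] by (simp add: scaleC_of_real)

lemma E_minus: "x \<in> A \<Longrightarrow> E (- x) = - E x"
  using E_scaleR[of x "-1"] by simp

lemma E_diff: "x \<in> A \<Longrightarrow> y \<in> A \<Longrightarrow> E (x - y) = E x - E y"
  using E_add[of x "- y"] by (simp add: E_minus inA)

lemma E_sum: "(\<And>i. i \<in> I \<Longrightarrow> f i \<in> A) \<Longrightarrow> E (\<Sum>i\<in>I. f i) = (\<Sum>i\<in>I. E (f i))"
  by (induction I rule: infinite_finite_induct) (auto simp: E_add inA)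

lemma E_psd_square: "x \<in> A \<Longrightarrow> psd (E (star x * x))"
  by (rule positives_psd[OF E_positive]) (auto simp: positives_def)

lemma E_psd:
  assumes "a \<in> A" "psd a" shows "psd (E a)"
proof -
  obtain s where s: "star s = s" "s * s = a" "s \<in> A"
    using psd_sqrt[OF assms(2)] assms(1) cstar_subalgebra_closed_real[OF subalgebra_A] by metis
  then show ?thesis using E_psd_square[of s] by simp
qed

lemma E_star:
  assumes "x \<in> A" shows "E (star x) = star (E x)"
proof -
  have sa: "star (E y) = E y" if y: "y \<in> A" "star y = y" for y
  proof -
    have p: "psd (E ((y + 1) * (y + 1)))" "psd (E ((y - 1) * (y - 1)))"
      using E_psd_square[of "y + 1"] E_psd_square[of "y - 1"] y
      by (simp_all add: inA star_add star_diff)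
    \<comment> \<open>A self-adjoint element is a difference of squares, and \<open>E\<close> maps squares to positive elements.\<close>
    have "4 *\<^sub>R y = (1 + 1 + 1 + 1 :: real) *\<^sub>R y" by simp
    also have "\<dots> = (y + 1) * (y + 1) - (y - 1) * (y - 1)"
      by (simp only: scaleR_add_left scaleR_one) (simp add: algebra_simps)
    finally have "4 *\<^sub>R y = (y + 1) * (y + 1) - (y - 1) * (y - 1)" .
    then have "4 *\<^sub>R E y = E ((y + 1) * (y + 1)) - E ((y - 1) * (y - 1))"
      using y by (simp flip: E_scaleR E_diff add: inA)
    then have "star (4 *\<^sub>R E y) = 4 *\<^sub>R E y"
      using p[THEN psd_selfadjoint] by (simp only: star_diff)
    then show ?thesis by (simp add: star_scaleR)
  qed
  obtain a b where ab: "star a = a" "star b = b" "x = a + \<i> *\<^sub>C b"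
      "a = (1/2) *\<^sub>R (x + star x)" "b = (-\<i>/2) *\<^sub>C (x - star x)"
    by (rule complex_decomposition)
  have A: "a \<in> A" "b \<in> A" using assms unfolding ab(4,5) by (intro inA assms)+
  have "star x = a + (- \<i>) *\<^sub>C b" unfolding ab(3) using ab(1,2) by (simp add: star_add star_scaleC)
  then have "E (star x) = E a + (- \<i>) *\<^sub>C E b" using A by (simp add: E_add E_scaleC inA)
  also have "\<dots> = star (E a + \<i> *\<^sub>C E b)" using A ab(1,2) sa by (simp add: star_add star_scaleC)
  also have "\<dots> = star (E x)" unfolding ab(3) using A by (simp add: E_add E_scaleC inA)
  finally show ?thesis .
qed

lemma E_contractive:
  assumes x: "x \<in> A" shows "norm (E x) \<le> norm x"
proof -
  define b where "b = E x"
  have b: "b \<in> B" "b \<in> A" using x by (simp_all add: b_def E_in E_A)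
  \<comment> \<open>Kadison--Schwarz: \<open>star (E x) * E x \<le> E (star x * x)\<close>.\<close>
  have "star (x - b) * (x - b) = star x * x - star x * b - star b * x + star b * b"
    by (simp add: star_diff algebra_simps)
  then have "E (star (x - b) * (x - b)) = E (star x * x) - star b * b"
    using x b by (simp add: E_add E_diff inA inB E_left E_right E_star E_fix b_def[symmetric])
  then have p1: "psd (E (star x * x) - star b * b)" using E_psd_square[of "x - b"] x b inA by metis
  have "psd (of_real ((norm x)\<^sup>2) - star x * x)"
    by (rule psd_norm_minus) (auto simp: star_mult star_star cstar_identity)
  then have "psd (E (of_real ((norm x)\<^sup>2) - star x * x))"
    using x by (intro E_psd inA)
  then have p2: "psd (of_real ((norm x)\<^sup>2) - E (star x * x))"
    using x E_diff[of "of_real ((norm x)\<^sup>2)" "star x * x"] E_of_real[of "(norm x)\<^sup>2"]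
    by (simp del: of_real_power E_of_real add: inA)
  have "psd (of_real ((norm x)\<^sup>2) - star b * b)" using psd_add[OF p1 p2] by simp
  then have "norm (star b * b) \<le> norm (of_real ((norm x)\<^sup>2) :: 'a)"
    by (rule psd_norm_mono[OF psd_star_mult_self])
  then have "(norm b)\<^sup>2 \<le> (norm x)\<^sup>2" unfolding cstar_identity norm_of_real by simp
  then show ?thesis by (simp add: b_def)
qed

lemma cond_expectation: "cond_expectation B A E"
  unfolding cond_expectation_def
  by (intro conjI ballI allI E_in E_fix E_add E_scaleC E_positive E_contractive E_bimodule)

lemma E_rel_commutant:
  assumes x: "x \<in> rel_commutant B A" and b: "b \<in> B" shows "E x * b = b * E x"
proof -
  have "x \<in> A" "b * x = x * b" using assms by (auto simp: rel_commutant_def)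
  then show ?thesis using E_left[OF b] E_right[OF b] by metis
qed

lemma E_rel_commutant_scalar:
  assumes "trivial_center B" "x \<in> rel_commutant B A"
  obtains c where "E x = c *\<^sub>C 1"
proof -
  have "E x \<in> B" using assms(2) by (simp add: rel_commutant_def E_in)
  moreover have "\<forall>b\<in>B. E x * b = b * E x" using E_rel_commutant[OF assms(2)] by blast
  ultimately show thesis using assms(1) that unfolding trivial_center_def by blast
qed

lemma subalgebra_rel_commutant: "cstar_subalgebra (rel_commutant B A)"
  by (intro cstar_subalgebra_rel_commutant subalgebra_A inB)

lemmas in_rel_commutant = subalgebra_intros[OF subalgebra_rel_commutant]

end

lemma positive_projectionI:
  assumes "cstar_subalgebra B" "cstar_subalgebra A" "B \<subseteq> A" "cond_expectation B A E"
  shows "positive_projection B A E"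
proof unfold_locales
  have E: "\<forall>x\<in>A. E x \<in> B" "\<forall>b\<in>B. E b = b" "\<forall>x\<in>A. \<forall>y\<in>A. E (x + y) = E x + E y"
    "\<forall>c. \<forall>x\<in>A. E (c *\<^sub>C x) = c *\<^sub>C E x" "\<forall>x\<in>positives A. E x \<in> positives B"
    "\<forall>a\<in>B. \<forall>b\<in>B. \<forall>x\<in>A. E (a * x * b) = a * E x * b"
    using assms(4) unfolding cond_expectation_def by blast+
  show "cstar_subalgebra B" "cstar_subalgebra A" "B \<subseteq> A" by (fact assms(1-3))+
  show "E x \<in> B" if "x \<in> A" for x using that E(1) by blast
  show "E b = b" if "b \<in> B" for b using that E(2) by blast
  show "E (x + y) = E x + E y" if "x \<in> A" "y \<in> A" for x y using that E(3) by blast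
  show "E (c *\<^sub>C x) = c *\<^sub>C E x" if "x \<in> A" for c x using that E(4) by blast
  show "E x \<in> positives B" if "x \<in> positives A" for x using that E(5) by blast
  show "E (a * x * b) = a * E x * b" if "a \<in> B" "b \<in> B" "x \<in> A" for a b x using that E(6) by blast
qed

locale finite_index = positive_projection B A E
  for B A :: "'a::cstar_algebra set" and E :: "'a \<Rightarrow> 'a" +
  fixes n :: nat and l :: "nat \<Rightarrow> 'a"
  assumes quasi_basis: "quasi_basis A E n l"
begin

lemma l_A: "i < n \<Longrightarrow> l i \<in> A"
  using quasi_basis by (simp add: quasi_basis_def)

lemma expand_left: "x \<in> A \<Longrightarrow> (\<Sum>i<n. l i * E (star (l i) * x)) = x"
  using quasi_basis by (simp add: quasi_basis_def)

lemma expand_right: "x \<in> A \<Longrightarrow> (\<Sum>i<n. E (x * l i) * star (l i)) = x"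
  using quasi_basis by (simp add: quasi_basis_def)

text \<open>
  The Cauchy--Schwarz inequality for the module inner product in its degenerate case: applying \<open>E\<close> to
  the square of \<open>x - t y z\<close> with \<open>z = E (star y * x)\<close> and dividing by \<open>t\<close> shows
  \<open>-2 (star z * z) + t G \<ge> 0\<close> for all \<open>t > 0\<close>.
\<close>

lemma E_null:
  assumes x: "x \<in> A" and y: "y \<in> A" and null: "E (star x * x) = 0"
  shows "E (star y * x) = 0"
proof -
  define z where "z = E (star y * x)"
  have zB: "z \<in> B" and zA: "z \<in> A" using x y by (simp_all add: z_def E_in E_A inA)
  have sz: "star z = E (star x * y)"
    using x y by (simp add: z_def inA star_mult star_star flip: E_star)
  define G where "G = star z * E (star y * y) * z"
  have "psd (- (2 *\<^sub>R (star z * z)) + t *\<^sub>R G)" if t: "0 < t" for t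
  proof -
    let ?w = "x - t *\<^sub>R (y * z)"
    have "star ?w * ?w = star x * x - t *\<^sub>R (star x * y * z) - t *\<^sub>R (star z * (star y * x))
        + (t * t) *\<^sub>R (star z * (star y * y) * z)"
      by (simp add: star_diff star_scaleR star_mult algebra_simps)
    then have "E (star ?w * ?w) = E (star x * x) - t *\<^sub>R (E (star x * y) * z) - t *\<^sub>R (star z * E (star y * x))
        + (t * t) *\<^sub>R G"
      using x y zA zB
      by (simp add: E_add E_diff E_scaleR E_left E_right E_bimodule inA inB G_def)
    also have "\<dots> = t *\<^sub>R (- (2 *\<^sub>R (star z * z)) + t *\<^sub>R G)"
      unfolding null sz[symmetric] z_def[symmetric] by (simp add: algebra_simps scaleR_2)
    finally have "psd (t *\<^sub>R (- (2 *\<^sub>R (star z * z)) + t *\<^sub>R G))"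
      using E_psd_square[of ?w] x y zA by (metis inA(4,6,8))
    then have "psd ((1/t) *\<^sub>R (t *\<^sub>R (- (2 *\<^sub>R (star z * z)) + t *\<^sub>R G)))"
      by (rule psd_scaleR) (use t in simp)
    moreover have "(1/t) *\<^sub>R (t *\<^sub>R v) = v" for v :: 'a using t by simp
    ultimately show ?thesis by (simp only:)
  qed
  moreover have "star (- (2 *\<^sub>R (star z * z))) = - (2 *\<^sub>R (star z * z))"
    by (simp add: star_minus star_scaleR star_mult star_star)
  ultimately have "psd (- (2 *\<^sub>R (star z * z)))"
    by (rule psd_limit[rotated])
  from psd_scaleR[OF this, of "1/2"] have "psd (- (star z * z))" by simp
  then show ?thesis using star_mult_self_nonpos_imp_0 z_def by blast
qed

lemma E_faithful:
  assumes x: "x \<in> A" and null: "E (star x * x) = 0" shows "x = 0"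
proof -
  have "x = (\<Sum>i<n. l i * E (star (l i) * x))" using expand_left x by simp
  also have "\<dots> = 0" using E_null[OF x _ null] l_A by (intro sum.neutral) auto
  finally show ?thesis .
qed

text \<open>
  The index weight. On \<open>B' \<inter> A\<close> it does not depend on the quasi-basis, and it is the
  counterpart of \<open>E\<close> for the inclusion of commutants \<open>A' \<subseteq> B'\<close>.
\<close>

definition \<psi> :: "'a \<Rightarrow> 'a" where
  "\<psi> x = (\<Sum>i<n. l i * x * star (l i))"

lemma psi_add: "\<psi> (x + y) = \<psi> x + \<psi> y"
  by (simp add: \<psi>_def algebra_simps sum.distrib)

lemma psi_diff: "\<psi> (x - y) = \<psi> x - \<psi> y"
  by (simp add: \<psi>_def algebra_simps sum_subtractf)

lemma psi_scaleR: "\<psi> (r *\<^sub>R x) = r *\<^sub>R \<psi> x"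
  by (simp add: \<psi>_def scaleR_sum_right)

lemma psi_scaleC: "\<psi> (c *\<^sub>C x) = c *\<^sub>C \<psi> x"
  by (simp add: \<psi>_def scaleC_sum_right mult_scaleC_left mult_scaleC_right)

lemma psi_star: "\<psi> (star x) = star (\<psi> x)"
  by (simp add: \<psi>_def star_sum star_mult star_star mult.assoc)

lemma psi_A: "x \<in> A \<Longrightarrow> \<psi> x \<in> A"
  unfolding \<psi>_def by (intro inA l_A) auto

lemma psi_psd: "psd (\<psi> (x * star x))"
  unfolding \<psi>_def
proof (intro psd_sum)
  show "psd (l i * (x * star x) * star (l i))" for i
    using psd_star_mult_self[of "star (l i * x)"] by (simp add: star_mult star_star mult.assoc)
qed

text \<open>
  Expand \<open>a * l i\<close> in the quasi-basis, move the coefficients from \<open>B\<close> past \<open>x\<close>, and collect them to the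
  expansion of \<open>star (l j) * a\<close>. The element \<open>x\<close> may lie outside \<open>A\<close>, as happens for composites of
  expectations.
\<close>

lemma psi_commutes:
  assumes c: "\<And>b. b \<in> B \<Longrightarrow> b * x = x * b" and a: "a \<in> A"
  shows "a * \<psi> x = \<psi> x * a"
proof -
  have "a * \<psi> x = (\<Sum>i<n. (a * l i) * x * star (l i))"
    by (simp add: \<psi>_def sum_distrib_left mult.assoc)
  also have "\<dots> = (\<Sum>i<n. (\<Sum>j<n. l j * E (star (l j) * (a * l i))) * x * star (l i))"
    using a l_A by (intro sum.cong) (auto simp: expand_left inA)
  also have "\<dots> = (\<Sum>i<n. \<Sum>j<n. l j * x * (E (star (l j) * a * l i) * star (l i)))"
  proof -
    have "E (star (l j) * (a * l i)) * x = x * E (star (l j) * a * l i)" if "i < n" "j < n" for i j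
      using c[of "E (star (l j) * (a * l i))"] that a l_A by (simp add: E_in inA mult.assoc)
    then show ?thesis
      unfolding sum_distrib_right by (intro sum.cong refl) (metis lessThan_iff mult.assoc)
  qed
  also have "\<dots> = (\<Sum>j<n. l j * x * (\<Sum>i<n. E (star (l j) * a * l i) * star (l i)))"
    by (subst sum.swap) (simp add: sum_distrib_left)
  also have "\<dots> = (\<Sum>j<n. l j * x * (star (l j) * a))"
    using a l_A by (intro sum.cong) (auto simp: expand_right inA)
  also have "\<dots> = \<psi> x * a" by (simp add: \<psi>_def sum_distrib_right mult.assoc)
  finally show ?thesis .
qed

lemma psi_scalar:
  assumes "trivial_center A" "x \<in> rel_commutant B A"
  obtains c where "\<psi> x = c *\<^sub>C 1"
proof -
  have x: "x \<in> A" "\<And>b. b \<in> B \<Longrightarrow> b * x = x * b" using assms(2) by (auto simp: rel_commutant_def)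
  show thesis using assms(1) psi_A[OF x(1)] psi_commutes[OF x(2)] that
    unfolding trivial_center_def by metis
qed

lemma norm_psi: "norm (\<psi> x) \<le> (\<Sum>i<n. (norm (l i))\<^sup>2) * norm x"
proof -
  have "norm (l i * x * star (l i)) \<le> (norm (l i))\<^sup>2 * norm x" for i
  proof -
    have "norm (l i * x * star (l i)) \<le> norm (l i * x) * norm (l i)"
      using norm_mult_ineq[of "l i * x" "star (l i)"] by simp
    also have "\<dots> \<le> (norm (l i) * norm x) * norm (l i)"
      by (intro mult_right_mono norm_mult_ineq) simp
    finally show ?thesis by (simp add: power2_eq_square mult_ac)
  qed
  then show ?thesis unfolding \<psi>_def sum_distrib_right by (rule sum_norm_le)
qed

lemma index_unique:
  assumes "quasi_basis A E m k"
  shows "(\<Sum>j<m. k j * star (k j)) = \<psi> 1"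
proof -
  have k: "\<And>j. j < m \<Longrightarrow> k j \<in> A" and e: "\<And>x. x \<in> A \<Longrightarrow> (\<Sum>j<m. k j * E (star (k j) * x)) = x"
    using assms by (auto simp: quasi_basis_def)
  have "\<psi> 1 = (\<Sum>i<n. (\<Sum>j<m. k j * E (star (k j) * l i)) * star (l i))"
    using e l_A by (simp add: \<psi>_def)
  also have "\<dots> = (\<Sum>j<m. k j * (\<Sum>i<n. E (star (k j) * l i) * star (l i)))"
    unfolding sum_distrib_right sum_distrib_left by (subst sum.swap) (simp add: mult.assoc)
  also have "\<dots> = (\<Sum>j<m. k j * star (k j))"
    using k by (intro sum.cong) (auto simp: expand_right inA)
  finally show ?thesis by simp
qed

lemma Ind_eq: "Ind A E = \<psi> 1"
  unfolding Ind_def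
proof (rule the_equality)
  show "\<exists>n l. quasi_basis A E n l \<and> \<psi> 1 = (\<Sum>i<n. l i * star (l i))"
    using quasi_basis by (intro exI[of _ n] exI[of _ l]) (simp add: \<psi>_def)
qed (use index_unique in auto)

lemma finite_index_expectation: "finite_index_expectation B A E"
  using cond_expectation quasi_basis by (auto simp: finite_index_expectation_def)

lemma has_scalar_index_iff: "has_scalar_index B A E r \<longleftrightarrow> \<psi> 1 = of_real r"
  by (simp add: has_scalar_index_def finite_index_expectation Ind_eq)

end


section \<open>Minimal expectations\<close>

context finite_index
begin

text \<open>
  The variation of \<open>E\<close> by a weight \<open>h\<close> in the relative commutant, with inverse \<open>g\<close>. Since \<open>g\<close>
  commutes with \<open>B\<close>, the quasi-basis \<open>l\<close> only has to be multiplied by \<open>g\<close> and normalized.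
\<close>

lemma weighted_expectation:
  assumes h: "h \<in> rel_commutant B A" "star h = h" and g: "g \<in> A" "h * g = 1" "g * h = 1"
    and D: "E (h * h) = of_real D" "D > 0"
  defines "F \<equiv> \<lambda>x. (1/D) *\<^sub>R E (h * x * h)" and "k \<equiv> \<lambda>i. sqrt D *\<^sub>R (l i * g)"
  shows "finite_index B A F n k" and "(\<Sum>i<n. k i * star (k i)) = D *\<^sub>R \<psi> (g * g)"
proof -
  have hA: "h \<in> A" and hc: "\<And>b. b \<in> B \<Longrightarrow> b * h = h * b"
    using h(1) by (auto simp: rel_commutant_def)
  have sg: "star g = g"
  proof -
    have "star g * h = 1" using g(2) h(2) by (metis star_mult star_one)
    then show ?thesis using g(2) by (metis mult.assoc mult_1_left mult.right_neutral)
  qed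
  have gc: "b * g = g * b" if "b \<in> B" for b
  proof -
    have "b * g = g * h * b * g" using g by simp
    also have "\<dots> = g * b * (h * g)" using hc[OF that] by (metis mult.assoc)
    finally show ?thesis using g by simp
  qed
  have kstar: "star (k i) = sqrt D *\<^sub>R (g * star (l i))" for i
    by (simp add: k_def star_scaleR star_mult sg)
  show "(\<Sum>i<n. k i * star (k i)) = D *\<^sub>R \<psi> (g * g)"
    using D(2) by (simp add: kstar) (simp add: k_def \<psi>_def scaleR_sum_right mult.assoc)
  have bim: "h * (a * x * b) * h = a * (h * x * h) * b" if "a \<in> B" "b \<in> B" for a b x
  proof -
    have "h * (a * x * b) * h = (h * a) * x * (b * h)" by (simp add: mult.assoc)
    also have "\<dots> = (a * h) * x * (h * b)" using hc that by simp
    finally show ?thesis by (simp add: mult.assoc)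
  qed
  show "finite_index B A F n k"
  proof unfold_locales
    show "cstar_subalgebra B" "cstar_subalgebra A" "B \<subseteq> A"
      by (fact subalgebra_B subalgebra_A B_subset)+
    show "F x \<in> B" if "x \<in> A" for x
      unfolding F_def using that hA by (intro inB E_in inA)
    show "F (x + y) = F x + F y" if "x \<in> A" "y \<in> A" for x y
      using that hA by (simp add: F_def distrib_left distrib_right E_add inA scaleR_add_right)
    show "F (c *\<^sub>C x) = c *\<^sub>C F x" if "x \<in> A" for c x
      using that hA
      by (simp add: F_def mult_scaleC_left mult_scaleC_right E_scaleC inA scaleC_scaleC mult.commute
          flip: scaleC_of_real)
    show F_bim: "F (a * x * b) = a * F x * b" if "a \<in> B" "b \<in> B" "x \<in> A" for a b x
      unfolding F_def bim[OF that(1,2)] using that hA by (simp add: E_bimodule inA)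
    show "F b = b" if "b \<in> B" for b
    proof -
      have "h * b * h = b * (h * h)" using hc[OF that] by (metis mult.assoc)
      then have "E (h * b * h) = b * of_real D" using that hA D by (simp add: E_left inA)
      then show ?thesis using D(2) by (simp add: F_def of_real_def)
    qed
    show "F x \<in> positives B" if "x \<in> positives A" for x
    proof -
      obtain y where y: "y \<in> A" "x = star y * y" using \<open>x \<in> positives A\<close> by (auto simp: positives_def)
      have "h * x * h = star (y * h) * (y * h)" by (simp add: y star_mult h mult.assoc)
      then have "E (h * x * h) \<in> positives B"
        using y hA by (intro E_positive) (auto simp: positives_def intro: inA)
      then obtain z where z: "z \<in> B" "E (h * x * h) = star z * z" by (auto simp: positives_def)
      have "F x = star (sqrt (1/D) *\<^sub>R z) * (sqrt (1/D) *\<^sub>R z)"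
        using D(2) z by (simp add: F_def star_scaleR)
      moreover have "sqrt (1/D) *\<^sub>R z \<in> B" using z(1) by (intro inB)
      ultimately show ?thesis unfolding positives_def by blast
    qed
    show "quasi_basis A F n k" unfolding quasi_basis_def
    proof (intro conjI ballI allI impI)
      show "k i \<in> A" if "i < n" for i using that g l_A by (auto simp: k_def intro: inA)
      fix x assume x: "x \<in> A"
      have "k i * F (star (k i) * x) = l i * E (star (l i) * (x * h)) * g" if i: "i < n" for i
      proof -
        have "h * (star (k i) * x) * h = sqrt D *\<^sub>R ((h * g) * (star (l i) * (x * h)))"
          by (simp add: kstar mult.assoc)
        then have "F (star (k i) * x) = (sqrt D / D) *\<^sub>R E (star (l i) * (x * h))"
          using g x hA i by (simp add: F_def E_scaleR inA l_A)
        then have "k i * F (star (k i) * x) = (sqrt D * sqrt D / D) *\<^sub>R (l i * (g * E (star (l i) * (x * h))))"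
          by (simp add: k_def mult.assoc)
        also have "\<dots> = l i * (g * E (star (l i) * (x * h)))" using D(2) by simp
        also have "g * E (star (l i) * (x * h)) = E (star (l i) * (x * h)) * g"
          using gc[of "E (star (l i) * (x * h))"] x hA i by (simp add: E_in inA l_A)
        finally show ?thesis by (simp add: mult.assoc)
      qed
      then have "(\<Sum>i<n. k i * F (star (k i) * x)) = (\<Sum>i<n. l i * E (star (l i) * (x * h))) * g"
        by (simp add: sum_distrib_right)
      also have "\<dots> = x" using x hA g by (simp add: expand_left inA mult.assoc)
      finally show "x = (\<Sum>i<n. k i * F (star (k i) * x))" by simp
      have "F (x * k i) * star (k i) = g * (E (h * x * l i) * star (l i))" if i: "i < n" for i
      proof -
        have "h * (x * k i) * h = sqrt D *\<^sub>R (h * x * l i * (g * h))"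
          by (simp add: k_def mult.assoc)
        then have "F (x * k i) = (sqrt D / D) *\<^sub>R E (h * x * l i)"
          using g x hA i by (simp add: F_def E_scaleR inA l_A)
        then have "F (x * k i) * star (k i) = (sqrt D * sqrt D / D) *\<^sub>R (E (h * x * l i) * g * star (l i))"
          by (simp add: kstar mult.assoc)
        also have "\<dots> = E (h * x * l i) * g * star (l i)" using D(2) by simp
        also have "E (h * x * l i) * g = g * E (h * x * l i)"
          using x hA i by (intro gc E_in inA l_A)
        finally show ?thesis by (simp add: mult.assoc)
      qed
      then have "(\<Sum>i<n. F (x * k i) * star (k i)) = g * (\<Sum>i<n. E (h * x * l i) * star (l i))"
        by (simp add: sum_distrib_left)
      also have "\<dots> = g * (h * x)" using x hA by (simp add: expand_right inA)
      also have "\<dots> = x" using g by (simp add: mult.assoc[symmetric])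
      finally show "x = (\<Sum>i<n. F (x * k i) * star (k i))" by simp
    qed
  qed
qed

end

text \<open>
  At a small \<open>t\<close> of sign opposite to \<open>\<delta>\<close> the linear term wins.
\<close>

lemma stationary_of_quadratic_bound:
  fixes \<delta> M T :: real
  assumes T: "T > 0" and M: "M \<ge> 0" and bd: "\<And>t. \<bar>t\<bar> \<le> T \<Longrightarrow> 0 \<le> t * \<delta> + t\<^sup>2 * M"
  shows "\<delta> = 0"
proof (rule ccontr)
  assume d: "\<delta> \<noteq> 0"
  define s where "s = min T (\<bar>\<delta>\<bar> / (M + 1))"
  have s: "0 < s" "s \<le> T" using T M d by (auto simp: s_def)
  have "s * (M + 1) \<le> \<bar>\<delta>\<bar>" using M unfolding s_def by (simp add: min_def pos_le_divide_eq)
  then have sM: "s * M < \<bar>\<delta>\<bar>" using s by (simp add: algebra_simps)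
  have "(- sgn \<delta> * s) * \<delta> + (- sgn \<delta> * s)\<^sup>2 * M = s * (s * M - \<bar>\<delta>\<bar>)"
    using d by (auto simp: sgn_if power2_eq_square algebra_simps)
  moreover have "\<dots> < 0" using s sM by (simp add: mult_less_0_iff)
  moreover have "\<bar>- sgn \<delta> * s\<bar> \<le> T" using s d by (auto simp: abs_mult sgn_if)
  ultimately show False using bd[of "- sgn \<delta> * s"] by linarith
qed

context finite_index
begin

text \<open>
  The index of the variation of \<open>E\<close> by \<open>h = 1 + t y\<close> is
  \<open>(1 + t\<^sup>2 \<gamma>) (r - 2 t \<delta> + O(t\<^sup>2))\<close> with \<open>\<psi> y = \<delta>\<close> and \<open>E (y * y) = \<gamma>\<close>. It is at least \<open>r\<close> for all small
  \<open>t\<close>, which forces \<open>\<delta> = 0\<close>.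
\<close>

lemma minimal_first_variation:
  assumes tB: "trivial_center B" and tA: "trivial_center A" and r: "\<psi> 1 = of_real r"
    and min: "\<And>F s. has_scalar_index B A F s \<Longrightarrow> r \<le> s"
    and y: "y \<in> rel_commutant B A" "star y = y" and Ey: "E y = 0"
  shows "\<psi> y = 0"
proof -
  have yA: "y \<in> A" using y by (simp add: rel_commutant_def)
  obtain d where d: "\<psi> y = d *\<^sub>C 1" using psi_scalar[OF tA y(1)] by blast
  define \<delta> where "\<delta> = Re d"
  have psiy: "\<psi> y = of_real \<delta>"
    using selfadjoint_scalar[of d] d psi_star[of y] y(2) unfolding \<delta>_def by metis
  have yy: "y * y \<in> rel_commutant B A" using y by (intro in_rel_commutant)
  obtain c where c: "E (y * y) = c *\<^sub>C 1" using E_rel_commutant_scalar[OF tB yy] by blast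
  define \<gamma> where "\<gamma> = Re c"
  have pyy: "psd (E (y * y))" using E_psd_square[OF yA] y(2) by simp
  have Eyy: "E (y * y) = of_real \<gamma>"
    using selfadjoint_scalar[of c] c psd_selfadjoint[OF pyy] unfolding \<gamma>_def by metis
  have \<gamma>: "\<gamma> \<ge> 0" using pyy unfolding Eyy psd_of_real .
  define L where "L = (\<Sum>i<n. (norm (l i))\<^sup>2)"
  have L: "L \<ge> 0" unfolding L_def by (intro sum_nonneg) simp
  define N where "N = norm y"
  have N: "N \<ge> 0" by (simp add: N_def)
  \<comment> \<open>\<open>K\<close> bounds the remainder of \<open>\<psi> (g * g)\<close>, where \<open>g = inverse h\<close>, divided by \<open>t\<^sup>2\<close>; the factor 4 comes from \<open>norm g \<le> 2\<close>.\<close>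
  define K where "K = L * (4 * (3 * N\<^sup>2 + 2 * N ^ 3))"
  have K: "K \<ge> 0" using L N by (simp add: K_def)
  define M where "M = K + \<gamma> * (\<bar>r\<bar> + 2 * \<bar>\<delta>\<bar> + K)"
  \<comment> \<open>For \<open>t\<close> up to \<open>T\<close> the perturbation \<open>t y\<close> has norm at most 1/2, so that \<open>h\<close> is invertible with \<open>norm g \<le> 2\<close>.\<close>
  define T where "T = 1 / (2 * (N + 1))"
  have T: "T > 0" "T \<le> 1" "T * N \<le> 1/2" using N by (auto simp: T_def field_simps)
  have "0 \<le> t * (-2 * \<delta>) + t\<^sup>2 * M" if t: "\<bar>t\<bar> \<le> T" for t
  proof -
    have tN: "norm (t *\<^sub>R y) \<le> 1/2"
    proof -
      have "norm (t *\<^sub>R y) = \<bar>t\<bar> * N" by (simp add: N_def)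
      also have "\<dots> \<le> T * N" using t N by (intro mult_right_mono)
      finally show ?thesis using T by simp
    qed
    define h where "h = 1 + t *\<^sub>R y"
    have h: "h \<in> rel_commutant B A" "star h = h"
      using y by (auto simp: h_def star_add star_scaleR intro!: in_rel_commutant)
    have "norm (- (t *\<^sub>R y)) < 1" using tN by simp
    then obtain g where g: "h * g = 1" "g * h = 1" "norm g \<le> 1 / (1 - norm (- (t *\<^sub>R y)))"
      "\<And>S. closed_real_subalgebra S \<Longrightarrow> - (t *\<^sub>R y) \<in> S \<Longrightarrow> g \<in> S"
      using neumann_inverse[of "- (t *\<^sub>R y)"] unfolding h_def by (metis diff_minus_eq_add)
    have gR: "g \<in> rel_commutant B A"
      by (rule g(4)[OF cstar_subalgebra_closed_real[OF subalgebra_rel_commutant]])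
         (intro in_rel_commutant y)
    then have gA: "g \<in> A" by (simp add: rel_commutant_def)
    have gn: "norm g \<le> 2"
    proof -
      have "1 / (1 - norm (- (t *\<^sub>R y))) \<le> 1 / (1/2)" using tN by (intro divide_left_mono) auto
      then show ?thesis using g(3) by simp
    qed
    define D where "D = 1 + t\<^sup>2 * \<gamma>"
    have D: "D > 0" using \<gamma> by (simp add: D_def add_pos_nonneg)
    have hh: "h * h = 1 + (2 * t) *\<^sub>R y + t\<^sup>2 *\<^sub>R (y * y)"
      by (simp add: h_def algebra_simps power2_eq_square scaleR_2 flip: scaleR_add_left)
    then have EhD: "E (h * h) = of_real D"
      using yA Ey Eyy by (simp add: E_add E_scaleR inA D_def) (simp add: of_real_def algebra_simps)
    define F where "F = (\<lambda>x. (1/D) *\<^sub>R E (h * x * h))"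
    define k where "k = (\<lambda>i. sqrt D *\<^sub>R (l i * g))"
    interpret F: finite_index B A F n k
      unfolding F_def k_def by (rule weighted_expectation(1)[OF h gA g(1,2) EhD D])
    have Find: "F.\<psi> 1 = D *\<^sub>R \<psi> (g * g)"
      using weighted_expectation(2)[OF h gA g(1,2) EhD D] unfolding F.\<psi>_def by (simp add: k_def)
    have ggR: "g * g \<in> rel_commutant B A" using gR by (intro in_rel_commutant)
    obtain u where u: "\<psi> (g * g) = u *\<^sub>C 1" using psi_scalar[OF tA ggR] by blast
    have sg: "star g = g"
    proof -
      have "star g * h = 1" using g(1) h(2) by (metis star_mult star_one)
      then show ?thesis using g(1) by (metis mult.assoc mult_1_left mult.right_neutral)
    qed
    define s where "s = Re u"
    have ps: "\<psi> (g * g) = of_real s"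
      using selfadjoint_scalar[of u] u psi_star[of "g * g"] sg unfolding s_def by (metis star_mult)
    have "F.\<psi> 1 = of_real (D * s)" unfolding Find ps by (simp add: of_real_def)
    then have rDs: "r \<le> D * s" using min F.has_scalar_index_iff by blast
    \<comment> \<open>Chosen so that \<open>(1 - 2 t y) h\<^sup>2 = 1 - t\<^sup>2 w\<close>; multiplying by \<open>g\<^sup>2\<close> gives the expansion of \<open>g\<^sup>2\<close>.\<close>
    define w where "w = 3 *\<^sub>R (y * y) + (2 * t) *\<^sub>R (y * y * y)"
    have gexp: "g * g = 1 - (2 * t) *\<^sub>R y + t\<^sup>2 *\<^sub>R (w * (g * g))"
    proof -
      have e: "(1 - (2 * t) *\<^sub>R y) * (h * h) = 1 - t\<^sup>2 *\<^sub>R w"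
      proof -
        have "(1 - (2 * t) *\<^sub>R y) * (h * h) = 1 + (2 * t - 2 * t) *\<^sub>R y
            + (t\<^sup>2 - 2 * t * (2 * t)) *\<^sub>R (y * y) - (2 * t * t\<^sup>2) *\<^sub>R (y * y * y)"
          unfolding hh by (simp only: left_diff_distrib right_diff_distrib distrib_left distrib_right
              mult_scaleR_left mult_scaleR_right scaleR_scaleR scaleR_left_diff_distrib mult_1_left
              mult_1_right mult.assoc) (simp add: algebra_simps)
        also have "\<dots> = 1 - t\<^sup>2 *\<^sub>R w"
        proof -
          have "t\<^sup>2 *\<^sub>R w = (3 * t\<^sup>2) *\<^sub>R (y * y) + (2 * t * t\<^sup>2) *\<^sub>R (y * y * y)"
            by (simp add: w_def scaleR_add_right mult.commute mult.left_commute)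
          moreover have "t\<^sup>2 - 2 * t * (2 * t) = - (3 * t\<^sup>2)" by (simp add: power2_eq_square)
          ultimately show ?thesis by simp
        qed
        finally show ?thesis .
      qed
      have hg: "h * h * (g * g) = 1" using g(1) by (metis mult.assoc mult_1_left)
      have "1 - (2 * t) *\<^sub>R y = (1 - (2 * t) *\<^sub>R y) * (h * h) * (g * g)"
        using hg by (simp add: mult.assoc)
      also have "\<dots> = g * g - t\<^sup>2 *\<^sub>R (w * (g * g))" unfolding e by (simp add: left_diff_distrib)
      finally show ?thesis by simp
    qed
    have "\<psi> (g * g) = of_real (r - 2 * t * \<delta>) + t\<^sup>2 *\<^sub>R \<psi> (w * (g * g))"
    proof -
      have "\<psi> (g * g) = \<psi> (1 - (2 * t) *\<^sub>R y + t\<^sup>2 *\<^sub>R (w * (g * g)))" using gexp by simp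
      also have "\<dots> = of_real r - (2 * t) *\<^sub>R of_real \<delta> + t\<^sup>2 *\<^sub>R \<psi> (w * (g * g))"
        by (simp only: psi_add psi_diff psi_scaleR r psiy)
      also have "(2 * t) *\<^sub>R of_real \<delta> = (of_real (2 * t * \<delta>) :: 'a)"
        by (simp only: of_real_def scaleR_scaleR)
      finally show ?thesis by (simp only: of_real_diff)
    qed
    then have "of_real (s - (r - 2 * t * \<delta>)) = t\<^sup>2 *\<^sub>R \<psi> (w * (g * g))"
      unfolding ps by simp
    then have "\<bar>s - (r - 2 * t * \<delta>)\<bar> = norm (t\<^sup>2 *\<^sub>R \<psi> (w * (g * g)))"
      by (metis norm_of_real)
    also have "\<dots> \<le> t\<^sup>2 * K"
    proof -
      have t1: "\<bar>t\<bar> \<le> 1" using t T by simp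
      have n3: "norm (y * y * y) \<le> N ^ 3"
        using norm_mult_ineq[of "y * y" y] mult_right_mono[OF norm_mult_ineq[of y y], of "norm y"]
        by (simp add: N_def power3_eq_cube)
      have "norm w \<le> norm (3 *\<^sub>R (y * y)) + norm ((2 * t) *\<^sub>R (y * y * y))"
        unfolding w_def by (rule norm_triangle_ineq)
      also have "\<dots> = 3 * norm (y * y) + 2 * (\<bar>t\<bar> * norm (y * y * y))" by (simp add: abs_mult)
      also have "\<dots> \<le> 3 * N\<^sup>2 + 2 * N ^ 3"
      proof -
        have "norm (y * y) \<le> N\<^sup>2" using norm_mult_ineq[of y y] by (simp add: N_def power2_eq_square)
        moreover have "\<bar>t\<bar> * norm (y * y * y) \<le> N ^ 3"
          using mult_left_le_one_le[of "norm (y * y * y)" "\<bar>t\<bar>"] t1 n3 by simp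
        ultimately show ?thesis by simp
      qed
      finally have wn: "norm w \<le> 3 * N\<^sup>2 + 2 * N ^ 3" .
      have "norm (g * g) \<le> 4"
        using norm_mult_ineq[of g g] mult_mono[OF gn gn] by simp
      then have "norm w * norm (g * g) \<le> (3 * N\<^sup>2 + 2 * N ^ 3) * 4"
        using wn N by (intro mult_mono) auto
      then have "norm (w * (g * g)) \<le> 4 * (3 * N\<^sup>2 + 2 * N ^ 3)"
        using norm_mult_ineq[of w "g * g"] by simp
      then have "norm (\<psi> (w * (g * g))) \<le> K"
        using norm_psi[of "w * (g * g)"] mult_left_mono[OF _ L] unfolding K_def L_def[symmetric]
        by (meson order_trans)
      then show ?thesis by (simp add: mult_left_mono)
    qed
    finally have "s \<le> r - 2 * t * \<delta> + t\<^sup>2 * K" by linarith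
    then have "D * s \<le> D * (r - 2 * t * \<delta> + t\<^sup>2 * K)" using D by (intro mult_left_mono) auto
    with rDs have "r \<le> D * (r - 2 * t * \<delta> + t\<^sup>2 * K)" by simp
    then have *: "0 \<le> t * (-2 * \<delta>) + t\<^sup>2 * (K + \<gamma> * (r - 2 * t * \<delta> + t\<^sup>2 * K))"
      by (simp add: D_def algebra_simps)
    have t1: "\<bar>t\<bar> \<le> 1" using t T by simp
    have "r - 2 * t * \<delta> + t\<^sup>2 * K \<le> \<bar>r\<bar> + 2 * \<bar>\<delta>\<bar> + K"
    proof -
      have "\<bar>t * \<delta>\<bar> \<le> \<bar>\<delta>\<bar>" using mult_left_le_one_le[of "\<bar>\<delta>\<bar>" "\<bar>t\<bar>"] t1 by (simp add: abs_mult)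
      moreover have "t\<^sup>2 * K \<le> K" using mult_left_le_one_le[of K "t\<^sup>2"] t1 K by (simp add: abs_square_le_1)
      ultimately show ?thesis by (simp add: mult.assoc)
    qed
    then have "K + \<gamma> * (r - 2 * t * \<delta> + t\<^sup>2 * K) \<le> M"
      unfolding M_def using \<gamma> by (intro add_left_mono mult_left_mono)
    then have "t\<^sup>2 * (K + \<gamma> * (r - 2 * t * \<delta> + t\<^sup>2 * K)) \<le> t\<^sup>2 * M" by (intro mult_left_mono) auto
    with * show ?thesis by linarith
  qed
  moreover have "M \<ge> 0" using K \<gamma> by (simp add: M_def)
  ultimately have "-2 * \<delta> = 0" by (intro stationary_of_quadratic_bound[OF T(1)])
  then show ?thesis using psiy by simp
qed

end

text \<open>
  The weights \<open>\<psi>\<close> and \<open>E\<close> are proportional on the relative commutant. This linear condition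
  replaces minimality in everything that follows.
\<close>

locale standard_expectation = finite_index B A E n l
  for B A :: "'a::cstar_algebra set" and E :: "'a \<Rightarrow> 'a" and n :: nat and l :: "nat \<Rightarrow> 'a" +
  fixes r :: real
  assumes psi_eq: "x \<in> rel_commutant B A \<Longrightarrow> \<psi> x = r *\<^sub>R E x"

text \<open>
  Subtracting the scalar \<open>E x\<close> and taking real and imaginary parts reduces the claim to
  self-adjoint elements in the kernel of \<open>E\<close>.
\<close>

theorem minimal_imp_standard:
  assumes "cstar_subalgebra B" "cstar_subalgebra A" "B \<subseteq> A"
    and tB: "trivial_center B" and tA: "trivial_center A" and min: "minimal_expectation B A E"
  obtains n l r where "standard_expectation B A E n l r" "Ind A E = of_real r"
proof -
  obtain r where r: "has_scalar_index B A E r" and le: "\<And>F s. has_scalar_index B A F s \<Longrightarrow> r \<le> s"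
    using min unfolding minimal_expectation_def by blast
  then obtain n l where ce: "cond_expectation B A E" and qb: "quasi_basis A E n l"
    unfolding has_scalar_index_def finite_index_expectation_def by blast
  interpret positive_projection B A E using assms(1-3) ce by (rule positive_projectionI)
  interpret finite_index B A E n l by unfold_locales (rule qb)
  have p1: "\<psi> 1 = of_real r" using r has_scalar_index_iff by blast
  have "\<psi> x = r *\<^sub>R E x" if x: "x \<in> rel_commutant B A" for x
  proof -
    have xA: "x \<in> A" using x by (simp add: rel_commutant_def)
    obtain c where c: "E x = c *\<^sub>C 1" using E_rel_commutant_scalar[OF tB x] by blast
    define x0 where "x0 = x - c *\<^sub>C 1"
    have x0: "x0 \<in> rel_commutant B A" unfolding x0_def by (intro in_rel_commutant x)
    have x0A: "x0 \<in> A" using x0 by (simp add: rel_commutant_def)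
    have Ex0: "E x0 = 0" unfolding x0_def using xA c by (simp add: E_diff E_scaleC inA)
    obtain a b where ab: "star a = a" "star b = b" "x0 = a + \<i> *\<^sub>C b"
        "a = (1/2) *\<^sub>R (x0 + star x0)" "b = (-\<i>/2) *\<^sub>C (x0 - star x0)"
      by (rule complex_decomposition)
    have R: "a \<in> rel_commutant B A" "b \<in> rel_commutant B A"
      unfolding ab(4,5) by (intro in_rel_commutant x0)+
    have "E a = 0" "E b = 0"
      unfolding ab(4,5) using x0A Ex0 by (simp_all add: E_scaleR E_scaleC E_add E_diff E_star inA)
    then have "\<psi> a = 0" "\<psi> b = 0"
      using R ab(1,2) by (auto intro!: minimal_first_variation[OF tB tA p1] le)
    then have "\<psi> x0 = 0" unfolding ab(3) by (simp add: psi_add psi_scaleC)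
    then have "\<psi> x = c *\<^sub>C of_real r" by (simp add: x0_def psi_diff psi_scaleC p1)
    also have "\<dots> = r *\<^sub>R E x"
      unfolding c of_real_conv_scaleC by (simp add: scaleC_scaleC mult.commute flip: scaleC_of_real)
    finally show ?thesis .
  qed
  then have "standard_expectation B A E n l r" by unfold_locales
  moreover have "Ind A E = of_real r" using p1 Ind_eq by simp
  ultimately show thesis using that by blast
qed


section \<open>Standard expectations centralize the relative commutant\<close>

context finite_index
begin

lemma E_nondegenerate:
  assumes "w \<in> A" "\<And>z. z \<in> A \<Longrightarrow> E (z * w) = 0" shows "w = 0"
  using E_faithful[OF assms(1)] assms(2)[of "star w"] assms(1) by (simp add: inA)

text \<open>
  The modular map of \<open>E\<close>. Right multiplication by \<open>star y\<close> is an operator on the module \<open>A\<close> that commutes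
  with left multiplications; its adjoint does so too, hence is right multiplication by an
  element, namely \<open>\<sigma> y\<close>.
\<close>

definition \<sigma> :: "'a \<Rightarrow> 'a" where
  "\<sigma> y = (\<Sum>i<n. l i * E (y * star (l i)))"

lemma sigma_A: "y \<in> A \<Longrightarrow> \<sigma> y \<in> A"
  unfolding \<sigma>_def by (intro inA E_A l_A) auto

text \<open>
  Moving the coefficients \<open>E (z * l i)\<close> through \<open>y\<close> reassembles the expansion of \<open>z\<close> in the quasi-basis.
\<close>

lemma E_mult_sum:
  assumes y: "y \<in> rel_commutant B A" and z: "z \<in> A" and w: "w \<in> A"
  shows "E (z * (\<Sum>i<n. l i * E (y * star (l i) * w))) = E (y * z * w)"
proof -
  have yA: "y \<in> A" using y by (simp add: rel_commutant_def)
  have "E (z * (\<Sum>i<n. l i * E (y * star (l i) * w))) = (\<Sum>i<n. E (z * (l i * E (y * star (l i) * w))))"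
    using yA z w l_A unfolding sum_distrib_left by (intro E_sum) (auto simp: inA E_A)
  also have "\<dots> = (\<Sum>i<n. E (y * (E (z * l i) * star (l i)) * w))"
  proof (intro sum.cong refl)
    fix i assume "i \<in> {..<n}"
    then have li: "l i \<in> A" using l_A by simp
    have c: "E (z * l i) * y = y * E (z * l i)"
      using rel_commutant_commutes[OF y E_in] z li by (simp add: inA)
    have "E (z * (l i * E (y * star (l i) * w))) = E (z * l i) * E (y * star (l i) * w)"
      using E_right[of "E (y * star (l i) * w)" "z * l i"] yA z w li by (simp add: mult.assoc inA E_in)
    also have "\<dots> = E (E (z * l i) * (y * star (l i) * w))"
      using yA z w li by (intro E_left[symmetric] inA E_in)
    also have "E (z * l i) * (y * star (l i) * w) = y * (E (z * l i) * star (l i)) * w"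
      using c by (metis mult.assoc)
    finally show "E (z * (l i * E (y * star (l i) * w))) = E (y * (E (z * l i) * star (l i)) * w)" .
  qed
  also have "\<dots> = E (\<Sum>i<n. y * (E (z * l i) * star (l i)) * w)"
    using yA z w l_A by (intro E_sum[symmetric]) (auto simp: inA E_A)
  also have "(\<Sum>i<n. y * (E (z * l i) * star (l i)) * w) = y * z * w"
    unfolding sum_distrib_left[symmetric] sum_distrib_right[symmetric] using expand_right[OF z] by simp
  finally show ?thesis .
qed

lemma E_modular:
  assumes y: "y \<in> rel_commutant B A" and z: "z \<in> A"
  shows "E (y * z) = E (z * \<sigma> y)"
  using E_mult_sum[OF y z inA(1)] by (simp add: \<sigma>_def)

lemma sum_eq_mult_sigma:
  assumes y: "y \<in> rel_commutant B A" and w: "w \<in> A"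
  shows "(\<Sum>i<n. l i * E (y * star (l i) * w)) = w * \<sigma> y"
proof -
  have yA: "y \<in> A" using y by (simp add: rel_commutant_def)
  have S: "(\<Sum>i<n. l i * E (y * star (l i) * w)) \<in> A" using yA w l_A by (intro inA E_A) auto
  have "(\<Sum>i<n. l i * E (y * star (l i) * w)) - w * \<sigma> y = 0"
  proof (rule E_nondegenerate)
    show "(\<Sum>i<n. l i * E (y * star (l i) * w)) - w * \<sigma> y \<in> A"
      by (intro inA S w sigma_A yA)
    fix z assume z: "z \<in> A"
    have "E (z * (w * \<sigma> y)) = E (y * z * w)"
      using E_modular[OF y, of "z * w"] z w by (simp add: inA mult.assoc)
    then show "E (z * ((\<Sum>i<n. l i * E (y * star (l i) * w)) - w * \<sigma> y)) = 0"
      using E_mult_sum[OF y z w] z w S sigma_A[OF yA] by (simp add: right_diff_distrib E_diff inA)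
  qed
  then show ?thesis by simp
qed

lemma sigma_rel_commutant:
  assumes y: "y \<in> rel_commutant B A" shows "\<sigma> y \<in> rel_commutant B A"
proof -
  have yA: "y \<in> A" using y by (simp add: rel_commutant_def)
  have "b * \<sigma> y = \<sigma> y * b" if b: "b \<in> B" for b
  proof -
    have "b * \<sigma> y - \<sigma> y * b = 0"
    proof (rule E_nondegenerate)
      show "b * \<sigma> y - \<sigma> y * b \<in> A" using B_A[OF b] sigma_A[OF yA] by (intro inA)
      fix z assume z: "z \<in> A"
      have "E (z * (b * \<sigma> y)) = E (y * z) * b"
        using E_modular[OF y, of "z * b"] E_right[OF b, of "y * z"] B_A[OF b] z yA
        by (simp add: inA mult.assoc)
      moreover have "E (z * (\<sigma> y * b)) = E (y * z) * b"
        using E_modular[OF y z] E_right[OF b, of "z * \<sigma> y"] z sigma_A[OF yA]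
        by (simp add: inA mult.assoc)
      ultimately show "E (z * (b * \<sigma> y - \<sigma> y * b)) = 0"
        using B_A[OF b] z sigma_A[OF yA] by (simp add: right_diff_distrib E_diff inA)
    qed
    then show ?thesis by simp
  qed
  then show ?thesis using sigma_A[OF yA] by (simp add: rel_commutant_def)
qed

lemma sigma_diff: "x \<in> A \<Longrightarrow> y \<in> A \<Longrightarrow> \<sigma> (x - y) = \<sigma> x - \<sigma> y"
  using l_A by (simp add: \<sigma>_def left_diff_distrib E_diff inA right_diff_distrib sum_subtractf)

text \<open>
  Compare \<open>E_modular\<close>, which on the relative commutant reads \<open>E (y * x) = E (x * \<sigma> y)\<close>: here \<open>\<sigma>\<close> appears
  on the other side.
\<close>

lemma psi_modular:
  assumes x: "x \<in> rel_commutant B A" and y: "y \<in> rel_commutant B A"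
  shows "\<psi> (x * y) = \<psi> (\<sigma> y * x)"
proof -
  have yA: "y \<in> A" using y by (simp add: rel_commutant_def)
  have "\<psi> (x * y) = (\<Sum>i<n. l i * x * (\<Sum>j<n. E (y * star (l i) * l j) * star (l j)))"
    unfolding \<psi>_def
  proof (intro sum.cong refl)
    fix i assume "i \<in> {..<n}"
    then have "(\<Sum>j<n. E (y * star (l i) * l j) * star (l j)) = y * star (l i)"
      using yA l_A by (intro expand_right inA) auto
    then show "l i * (x * y) * star (l i) = l i * x * (\<Sum>j<n. E (y * star (l i) * l j) * star (l j))"
      by (simp only: mult.assoc)
  qed
  also have "\<dots> = (\<Sum>i<n. \<Sum>j<n. l i * E (y * star (l i) * l j) * (x * star (l j)))"
    unfolding sum_distrib_left
  proof (intro sum.cong refl)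
    fix i j assume "i \<in> {..<n}" "j \<in> {..<n}"
    then have "E (y * star (l i) * l j) * x = x * E (y * star (l i) * l j)"
      using yA l_A by (intro rel_commutant_commutes[OF x] E_in inA) auto
    then show "l i * x * (E (y * star (l i) * l j) * star (l j))
        = l i * E (y * star (l i) * l j) * (x * star (l j))"
      by (metis mult.assoc)
  qed
  also have "\<dots> = (\<Sum>j<n. (\<Sum>i<n. l i * E (y * star (l i) * l j)) * (x * star (l j)))"
    by (subst sum.swap) (simp add: sum_distrib_right)
  also have "\<dots> = (\<Sum>j<n. l j * \<sigma> y * (x * star (l j)))"
    using l_A by (intro sum.cong refl) (simp add: sum_eq_mult_sigma[OF y])
  finally show ?thesis by (simp add: \<psi>_def mult.assoc)
qed

text \<open>
  If a sum of positive elements \<open>l i * star (l i)\<close> vanishes then every \<open>l i\<close> does, and the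
  quasi-basis could not even represent \<open>1\<close>.
\<close>

lemma psi_1_nonzero: "\<psi> 1 \<noteq> 0"
proof
  assume 0: "\<psi> 1 = 0"
  have "l j = 0" if j: "j < n" for j
  proof -
    have "\<psi> 1 = l j * star (l j) + (\<Sum>i\<in>{..<n}-{j}. l i * star (l i))"
      unfolding \<psi>_def using j by (subst sum.remove[of _ j]) auto
    then have "- (star (star (l j)) * star (l j)) = (\<Sum>i\<in>{..<n}-{j}. star (star (l i)) * star (l i))"
      using 0 by (simp add: star_star neg_eq_iff_add_eq_0)
    then have "star (l j) = 0"
      by (intro star_mult_self_nonpos_imp_0) (auto intro: psd_sum psd_star_mult_self)
    then show ?thesis by (metis star_star star_zero)
  qed
  then have "(\<Sum>i<n. l i * E (star (l i) * 1)) = 0" by (intro sum.neutral) auto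
  then show False using expand_left[OF inA(1)] by simp
qed

end

context standard_expectation
begin

lemma psi_1: "\<psi> 1 = of_real r"
  using psi_eq[of 1] by (simp add: in_rel_commutant of_real_def)

lemma r_pos: "r > 0"
proof -
  have "r \<noteq> 0" using psi_1_nonzero psi_1 by auto
  moreover have "r \<ge> 0" using psi_psd[of 1] unfolding psd_of_real[symmetric, where 'a = 'a] psi_1[symmetric] by simp
  ultimately show ?thesis by simp
qed

text \<open>
  If \<open>\<psi>\<close> is proportional to \<open>E\<close>, the two modular relations combine to \<open>\<sigma> (\<sigma> w) = w\<close>. Then
  \<open>v = y - \<sigma> y\<close> satisfies \<open>\<sigma> v = - v\<close>, so \<open>E (v * star v) = - E (star v * v)\<close>, where both expectations are positive.
  Hence \<open>v = 0\<close>.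
\<close>

theorem E_commute:
  assumes y: "y \<in> rel_commutant B A" and z: "z \<in> A"
  shows "E (y * z) = E (z * y)"
proof -
  have sub: "x \<in> A" if "x \<in> rel_commutant B A" for x using that by (simp add: rel_commutant_def)
  note sig = sigma_rel_commutant
  have swap: "E (x * w) = E (\<sigma> w * x)" if xw: "x \<in> rel_commutant B A" "w \<in> rel_commutant B A" for x w
  proof -
    have "r *\<^sub>R E (x * w) = r *\<^sub>R E (\<sigma> w * x)"
      using psi_modular[OF xw] psi_eq[OF in_rel_commutant(6)[OF xw]]
        psi_eq[OF in_rel_commutant(6)[OF sig[OF xw(2)] xw(1)]] by simp
    then show ?thesis using r_pos by simp
  qed
  have inv: "\<sigma> (\<sigma> w) = w" if w: "w \<in> rel_commutant B A" for w
  proof -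
    define u where "u = \<sigma> (\<sigma> w) - w"
    have u: "u \<in> rel_commutant B A" unfolding u_def by (intro in_rel_commutant sig w)
    have su: "star u \<in> rel_commutant B A" by (intro in_rel_commutant u)
    have "E (\<sigma> (\<sigma> w) * star u) = E (star u * \<sigma> w)" using swap[OF su sig[OF w]] by simp
    also have "\<dots> = E (w * star u)" using E_modular[OF w sub[OF su]] by simp
    finally have "E (u * star u) = 0"
      using sub[OF w] sub[OF su] sub[OF sig[OF sig[OF w]]] unfolding u_def
      by (simp add: left_diff_distrib E_diff inA)
    then have "star u = 0" using E_faithful[OF sub[OF su]] by (simp add: star_star)
    then have "u = 0" by (metis star_star star_zero)
    then show ?thesis by (simp add: u_def)
  qed
  define v where "v = y - \<sigma> y"
  have v: "v \<in> rel_commutant B A" unfolding v_def by (intro in_rel_commutant sig y)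
  have sv: "star v \<in> A" by (intro inA sub v)
  have "\<sigma> v = - v" unfolding v_def by (simp add: sigma_diff sub y sig inv)
  then have "E (v * star v) = - E (star v * v)"
    using E_modular[OF v sv] sub[OF v] by (simp add: E_minus inA)
  then have "psd (- E (star v * v))"
    using E_psd_square[OF sv] by (simp add: star_star)
  then have "E (star v * v) = 0" using psd_antisym E_psd_square[OF sub[OF v]] by blast
  then have "v = 0" using E_faithful[OF sub[OF v]] by blast
  then show ?thesis using E_modular[OF y z] by (simp add: v_def)
qed

end

section \<open>Composition\<close>

text \<open>
  The products \<open>k a * l b\<close> of the two quasi-bases form one for \<open>E \<circ> F\<close>, so its index weight is
  \<open>F.\<psi> \<circ> E.\<psi>\<close>. For \<open>x\<close> commuting with \<open>B\<close> the element \<open>E.\<psi> x\<close> commutes with \<open>A\<close>, and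
  \<open>F.\<psi> (E.\<psi> x) = s F (E.\<psi> x) = s E.\<psi> (F x) = s r E (F x)\<close>.
\<close>

theorem standard_expectation_compose:
  assumes E: "standard_expectation B A E n l r" and F: "standard_expectation A A1 F m k s"
  obtains p where "standard_expectation B A1 (E \<circ> F) (m * n) p (r * s)"
proof -
  interpret E: standard_expectation B A E n l r by fact
  interpret F: standard_expectation A A1 F m k s by fact
  have "card ({..<m} \<times> {..<n}) = m * n" by (simp add: card_cartesian_product)
  then obtain h where h: "bij_betw h {..<m * n} ({..<m} \<times> {..<n})"
    using ex_bij_betw_nat_finite[of "{..<m} \<times> {..<n}"] by (auto simp: atLeast0LessThan)
  define p where "p i = (case h i of (a, b) \<Rightarrow> k a * l b)" for i
  have sum: "(\<Sum>i<m * n. G (p i)) = (\<Sum>a<m. \<Sum>b<n. G (k a * l b))" for G :: "'a \<Rightarrow> 'a"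
  proof -
    have "(\<Sum>i<m * n. G (p i)) = (\<Sum>i<m * n. (\<lambda>(a, b). G (k a * l b)) (h i))"
      by (intro sum.cong refl) (simp add: p_def split: prod.split)
    also have "\<dots> = (\<Sum>(a, b)\<in>{..<m} \<times> {..<n}. G (k a * l b))"
      by (rule sum.reindex_bij_betw[OF h])
    also have "\<dots> = (\<Sum>a<m. \<Sum>b<n. G (k a * l b))" by (simp add: sum.cartesian_product)
    finally show ?thesis .
  qed
  have lA1: "l b \<in> A1" if "b < n" for b using E.l_A[OF that] F.B_A by blast
  have "standard_expectation B A1 (E \<circ> F) (m * n) p (r * s)"
  proof -
    interpret G: finite_index B A1 "E \<circ> F" "m * n" p
    proof unfold_locales
      show "cstar_subalgebra B" "cstar_subalgebra A1" "B \<subseteq> A1"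
        using E.subalgebra_B F.subalgebra_A E.B_subset F.B_subset by auto
      show "(E \<circ> F) x \<in> B" if "x \<in> A1" for x using that by (simp add: E.E_in F.E_in)
      show "(E \<circ> F) b = b" if "b \<in> B" for b using that by (simp add: E.E_fix F.E_fix E.B_A)
      show "(E \<circ> F) (x + y) = (E \<circ> F) x + (E \<circ> F) y" if "x \<in> A1" "y \<in> A1" for x y
        using that by (simp add: E.E_add F.E_add F.E_in)
      show "(E \<circ> F) (c *\<^sub>C x) = c *\<^sub>C (E \<circ> F) x" if "x \<in> A1" for c x
        using that by (simp add: E.E_scaleC F.E_scaleC F.E_in)
      show "(E \<circ> F) x \<in> positives B" if "x \<in> positives A1" for x
        using that by (simp add: E.E_positive F.E_positive)
      show "(E \<circ> F) (a * x * b) = a * (E \<circ> F) x * b" if "a \<in> B" "b \<in> B" "x \<in> A1" for a b x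
        using that by (simp add: E.E_bimodule F.E_bimodule F.E_in E.B_A)
      show "quasi_basis A1 (E \<circ> F) (m * n) p" unfolding quasi_basis_def
      proof (intro conjI ballI allI impI)
        show "p i \<in> A1" if "i < m * n" for i
        proof -
          have "h i \<in> {..<m} \<times> {..<n}" using h that unfolding bij_betw_def by blast
          then obtain a b where "h i = (a, b)" "a < m" "b < n" by auto
          then show ?thesis using F.l_A lA1 by (simp add: p_def F.inA)
        qed
        fix x assume x: "x \<in> A1"
        have "(\<Sum>i<m * n. p i * (E \<circ> F) (star (p i) * x))
            = (\<Sum>a<m. k a * (\<Sum>b<n. l b * E (star (l b) * F (star (k a) * x))))"
          unfolding sum[of "\<lambda>q. q * (E \<circ> F) (star q * x)"] sum_distrib_left
        proof (intro sum.cong refl)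
          fix a b assume ab: "a \<in> {..<m}" "b \<in> {..<n}"
          have "F (star (k a * l b) * x) = star (l b) * F (star (k a) * x)"
            using F.E_left[of "star (l b)" "star (k a) * x"] ab E.l_A F.l_A x
            by (simp add: star_mult mult.assoc E.inA F.inA)
          then show "k a * l b * (E \<circ> F) (star (k a * l b) * x) = k a * (l b * E (star (l b) * F (star (k a) * x)))"
            by (simp add: mult.assoc)
        qed
        also have "\<dots> = (\<Sum>a<m. k a * F (star (k a) * x))"
          using F.l_A x by (intro sum.cong refl) (simp add: E.expand_left F.E_in F.inA)
        also have "\<dots> = x" using x by (rule F.expand_left)
        finally show "x = (\<Sum>i<m * n. p i * (E \<circ> F) (star (p i) * x))" by simp
        have "(\<Sum>i<m * n. (E \<circ> F) (x * p i) * star (p i))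
            = (\<Sum>a<m. (\<Sum>b<n. E (F (x * k a) * l b) * star (l b)) * star (k a))"
          unfolding sum[of "\<lambda>q. (E \<circ> F) (x * q) * star q"] sum_distrib_right
        proof (intro sum.cong refl)
          fix a b assume ab: "a \<in> {..<m}" "b \<in> {..<n}"
          have "F (x * (k a * l b)) = F (x * k a) * l b"
            using F.E_right[of "l b" "x * k a"] ab E.l_A F.l_A x
            by (simp add: mult.assoc F.inA)
          then show "(E \<circ> F) (x * (k a * l b)) * star (k a * l b) = E (F (x * k a) * l b) * star (l b) * star (k a)"
            by (simp add: star_mult mult.assoc)
        qed
        also have "\<dots> = (\<Sum>a<m. F (x * k a) * star (k a))"
          using F.l_A x by (intro sum.cong refl) (simp add: E.expand_right F.E_in F.inA)
        also have "\<dots> = x" using x by (rule F.expand_right)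
        finally show "x = (\<Sum>i<m * n. (E \<circ> F) (x * p i) * star (p i))" by simp
      qed
    qed
    show ?thesis
    proof (rule standard_expectation.intro[OF G.finite_index_axioms standard_expectation_axioms.intro])
      fix x assume x: "x \<in> rel_commutant B A1"
      have xA: "x \<in> A1" and xc: "\<And>b. b \<in> B \<Longrightarrow> b * x = x * b" using x by (auto simp: rel_commutant_def)
      have "G.\<psi> x = (\<Sum>a<m. k a * E.\<psi> x * star (k a))"
        unfolding G.\<psi>_def E.\<psi>_def sum[of "\<lambda>q. q * x * star q"] sum_distrib_left sum_distrib_right
        by (simp add: star_mult mult.assoc)
      then have 1: "G.\<psi> x = F.\<psi> (E.\<psi> x)" by (simp add: F.\<psi>_def)
      have "E.\<psi> x \<in> A1" unfolding E.\<psi>_def using xA lA1 by (intro F.inA) auto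
      then have "E.\<psi> x \<in> rel_commutant A A1"
        using E.psi_commutes[OF xc] by (simp add: rel_commutant_def)
      then have 2: "F.\<psi> (E.\<psi> x) = s *\<^sub>R F (E.\<psi> x)" by (rule F.psi_eq)
      have "F (E.\<psi> x) = (\<Sum>i<n. F (l i * x * star (l i)))"
        unfolding E.\<psi>_def using xA lA1 by (intro F.E_sum F.inA) auto
      also have "\<dots> = E.\<psi> (F x)"
        unfolding E.\<psi>_def using xA E.l_A by (intro sum.cong refl F.E_bimodule) (auto intro: E.inA)
      finally have 3: "F (E.\<psi> x) = E.\<psi> (F x)" .
      have "b * F x = F x * b" if "b \<in> B" for b
        using xc[OF that] F.E_left[of b x] F.E_right[of b x] E.B_A[OF that] xA by metis
      then have "F x \<in> rel_commutant B A" using xA by (simp add: rel_commutant_def F.E_in)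
      then have "E.\<psi> (F x) = r *\<^sub>R E (F x)" by (rule E.psi_eq)
      then show "G.\<psi> x = (r * s) *\<^sub>R (E \<circ> F) x" using 1 2 3 by (simp add: mult.commute)
    qed
  qed
  then show thesis using that by blast
qed


section \<open>The basic construction\<close>

text \<open>
  Adjointable maps are automatically right \<open>B\<close>-linear, so the elements of \<open>A1\<close> act on \<open>A\<close> by
  \<open>B\<close>-linear maps, and identities in \<open>A1\<close> can be checked on \<open>A\<close> because \<open>\<pi>\<close> is injective.
\<close>

locale basic_construction = finite_index B A E n l
  for B A :: "'a::cstar_algebra set" and E :: "'a \<Rightarrow> 'a" and n :: nat and l :: "nat \<Rightarrow> 'a" +
  fixes A1 :: "'a set" and e :: 'a
  assumes construction: "is_basic_construction B A E A1 e"
begin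

definition \<pi> :: "'a \<Rightarrow> 'a \<Rightarrow> 'a" where
  "\<pi> = (SOME \<pi>. inj_on \<pi> A1 \<and>
        (\<forall>x\<in>A1. \<forall>y\<in>A1. \<pi> (x + y) = (\<lambda>z\<in>A. \<pi> x z + \<pi> y z)) \<and>
        (\<forall>x\<in>A1. \<forall>y\<in>A1. \<pi> (x * y) = compose A (\<pi> x) (\<pi> y)) \<and>
        (\<forall>x\<in>A1. adjoint_pair A E (\<pi> x) (\<pi> (star x))) \<and>
        (\<forall>a\<in>A. \<pi> a = left_mult A a) \<and>
        \<pi> e = restrict E A)"

lemma pi:
  shows "inj_on \<pi> A1"
    and "\<forall>x\<in>A1. \<forall>y\<in>A1. \<pi> (x + y) = (\<lambda>z\<in>A. \<pi> x z + \<pi> y z)"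
    and "\<forall>x\<in>A1. \<forall>y\<in>A1. \<pi> (x * y) = compose A (\<pi> x) (\<pi> y)"
    and "\<forall>x\<in>A1. adjoint_pair A E (\<pi> x) (\<pi> (star x))"
    and "\<forall>a\<in>A. \<pi> a = left_mult A a"
    and "\<pi> e = restrict E A"
proof -
  have "\<exists>\<pi>. inj_on \<pi> A1 \<and>
        (\<forall>x\<in>A1. \<forall>y\<in>A1. \<pi> (x + y) = (\<lambda>z\<in>A. \<pi> x z + \<pi> y z)) \<and>
        (\<forall>x\<in>A1. \<forall>y\<in>A1. \<pi> (x * y) = compose A (\<pi> x) (\<pi> y)) \<and>
        (\<forall>x\<in>A1. adjoint_pair A E (\<pi> x) (\<pi> (star x))) \<and>
        (\<forall>a\<in>A. \<pi> a = left_mult A a) \<and>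
        \<pi> e = restrict E A"
    using construction unfolding is_basic_construction_def bij_betw_def by (elim conjE exE) (intro exI conjI)
  note pi = someI_ex[OF this, folded \<pi>_def]
  show "inj_on \<pi> A1"
    "\<forall>x\<in>A1. \<forall>y\<in>A1. \<pi> (x + y) = (\<lambda>z\<in>A. \<pi> x z + \<pi> y z)"
    "\<forall>x\<in>A1. \<forall>y\<in>A1. \<pi> (x * y) = compose A (\<pi> x) (\<pi> y)"
    "\<forall>x\<in>A1. adjoint_pair A E (\<pi> x) (\<pi> (star x))"
    "\<forall>a\<in>A. \<pi> a = left_mult A a"
    "\<pi> e = restrict E A"
    using pi by - (elim conjE, assumption)+
qed

lemma subalgebra_A1: "cstar_subalgebra A1" and A_A1: "a \<in> A \<Longrightarrow> a \<in> A1" and e_A1: "e \<in> A1"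
  using construction unfolding is_basic_construction_def by auto

lemmas inA1 = subalgebra_intros[OF subalgebra_A1]

lemma pi_add: "x \<in> A1 \<Longrightarrow> y \<in> A1 \<Longrightarrow> z \<in> A \<Longrightarrow> \<pi> (x + y) z = \<pi> x z + \<pi> y z"
  using pi(2) by simp

lemma pi_mult: "x \<in> A1 \<Longrightarrow> y \<in> A1 \<Longrightarrow> z \<in> A \<Longrightarrow> \<pi> (x * y) z = \<pi> x (\<pi> y z)"
  using pi(3) by (simp add: compose_def)

lemma pi_left: "a \<in> A \<Longrightarrow> z \<in> A \<Longrightarrow> \<pi> a z = a * z"
  using pi(5) by (simp add: left_mult_def)

lemma pi_e: "z \<in> A \<Longrightarrow> \<pi> e z = E z"
  using pi(6) by simp

lemma pi_funcset: "x \<in> A1 \<Longrightarrow> \<pi> x \<in> A \<rightarrow>\<^sub>E A"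
  using pi(4) by (auto simp: adjoint_pair_def)

lemma pi_A: "x \<in> A1 \<Longrightarrow> z \<in> A \<Longrightarrow> \<pi> x z \<in> A"
  using pi_funcset by (meson PiE_mem)

lemma pi_adjoint: "x \<in> A1 \<Longrightarrow> z \<in> A \<Longrightarrow> w \<in> A \<Longrightarrow> E (star (\<pi> x z) * w) = E (star z * \<pi> (star x) w)"
  using pi(4) unfolding adjoint_pair_def by blast

lemma pi_eqI:
  assumes "x \<in> A1" "y \<in> A1" "\<And>z. z \<in> A \<Longrightarrow> \<pi> x z = \<pi> y z"
  shows "x = y"
proof (rule inj_onD[OF pi(1) _ assms(1,2)])
  show "\<pi> x = \<pi> y" by (rule PiE_ext[OF pi_funcset[OF assms(1)] pi_funcset[OF assms(2)] assms(3)])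
qed

lemma pi_0: "z \<in> A \<Longrightarrow> \<pi> 0 z = 0"
  using pi_left[of 0 z] by (simp add: inA)

lemma pi_sum: "(\<And>i. i \<in> I \<Longrightarrow> f i \<in> A1) \<Longrightarrow> z \<in> A \<Longrightarrow> \<pi> (\<Sum>i\<in>I. f i) z = (\<Sum>i\<in>I. \<pi> (f i) z)"
  by (induction I rule: infinite_finite_induct) (auto simp: pi_0 pi_add inA1)

lemma pi_right_linear:
  assumes x: "x \<in> A1" and z: "z \<in> A" and b: "b \<in> B"
  shows "\<pi> x (z * b) = \<pi> x z * b"
proof -
  note bA = B_A[OF b]
  define d where "d = \<pi> x (z * b) - \<pi> x z * b"
  have dA: "d \<in> A" unfolding d_def by (intro inA pi_A x z bA)
  have sb: "star b \<in> B" using b by (intro inB)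
  have "star d * d = star (\<pi> x (z * b)) * d - star b * (star (\<pi> x z) * d)"
    unfolding d_def by (simp add: star_diff star_mult left_diff_distrib mult.assoc)
  then have "E (star d * d) = E (star (\<pi> x (z * b)) * d) - E (star b * (star (\<pi> x z) * d))"
    using dA x z bA by (simp add: E_diff inA pi_A)
  also have "E (star b * (star (\<pi> x z) * d)) = star b * E (star z * \<pi> (star x) d)"
    using sb x z dA by (simp add: E_left inA pi_A pi_adjoint)
  also have "E (star (\<pi> x (z * b)) * d) = E (star (z * b) * \<pi> (star x) d)"
    using x z bA dA by (intro pi_adjoint inA)
  also have "\<dots> = star b * E (star z * \<pi> (star x) d)"
    using E_left[OF sb, of "star z * \<pi> (star x) d"] x z dA by (simp add: star_mult mult.assoc inA pi_A inA1)
  finally have "d = 0" using E_faithful[OF dA] by simp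
  then show ?thesis by (simp add: d_def)
qed

lemma e_selfadjoint: "star e = e"
proof (rule pi_eqI[OF inA1(9)[OF e_A1] e_A1])
  fix w assume w: "w \<in> A"
  have se: "star e \<in> A1" using e_A1 by (intro inA1)
  have "\<pi> (star e) w - E w = 0"
  proof (rule E_nondegenerate)
    show "\<pi> (star e) w - E w \<in> A" by (intro inA pi_A se w E_A)
    fix z assume z: "z \<in> A"
    have sz: "star z \<in> A" using z by (intro inA)
    have "E (z * \<pi> (star e) w) = E (star (E (star z)) * w)"
      using pi_adjoint[OF e_A1 sz w] by (simp add: pi_e sz star_star)
    also have "\<dots> = E z * E w" using z w by (simp add: E_star star_star E_left E_in)
    also have "\<dots> = E (z * E w)" using z w by (simp add: E_right E_in)
    finally show "E (z * (\<pi> (star e) w - E w)) = 0"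
      using z w se by (simp add: right_diff_distrib E_diff inA pi_A E_A)
  qed
  then show "\<pi> (star e) w = \<pi> e w" using w by (simp add: pi_e)
qed

lemma e_compress: "a \<in> A \<Longrightarrow> e * a * e = E a * e"
  by (rule pi_eqI) (auto simp: pi_mult pi_left pi_e inA1 e_A1 A_A1 E_A inA E_in E_fix B_A E_right E_left)

lemma e_idempotent: "e * e = e"
  using e_compress[of 1] by (simp add: inA)

lemma e_commutes: "b \<in> B \<Longrightarrow> b * e = e * b"
  by (rule pi_eqI) (auto simp: pi_mult pi_left pi_e inA1 e_A1 A_A1 E_A inA E_in E_fix B_A E_right E_left)

lemma mult_e_inj: "a \<in> A \<Longrightarrow> a * e = 0 \<Longrightarrow> a = 0"
  using pi_mult[OF A_A1 e_A1, of a 1] pi_0[of 1] by (simp add: pi_left pi_e inA)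

lemma sum_e: "(\<Sum>i<n. l i * e * star (l i)) = 1"
proof (rule pi_eqI)
  have A1: "l i * e * star (l i) \<in> A1" if "i < n" for i
    using A_A1[OF l_A[OF that]] by (intro inA1 e_A1)
  then show "(\<Sum>i<n. l i * e * star (l i)) \<in> A1" by (intro subalgebra_sum[OF subalgebra_A1]) auto
  show "1 \<in> A1" by (rule inA1)
  fix z assume z: "z \<in> A"
  have "\<pi> (\<Sum>i<n. l i * e * star (l i)) z = (\<Sum>i<n. l i * E (star (l i) * z))"
    using z A1 l_A by (subst pi_sum) (auto simp: pi_mult pi_left pi_e inA1 e_A1 A_A1 E_A inA)
  then show "\<pi> (\<Sum>i<n. l i * e * star (l i)) z = \<pi> 1 z"
    using z by (simp add: expand_left pi_left inA)
qed

text \<open>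
  As operators, \<open>x * e\<close> and \<open>\<pi> x 1 * e\<close> both send \<open>z\<close> to \<open>\<pi> x 1 * E z\<close>. Together with \<open>sum_e\<close> this shows that
  \<open>A1\<close> is the linear span of \<open>A e A\<close>.
\<close>

lemma mult_e:
  assumes "x \<in> A1" obtains a where "a \<in> A" "x * e = a * e"
proof (rule that)
  show "\<pi> x 1 \<in> A" using assms by (intro pi_A inA)
  show "x * e = \<pi> x 1 * e"
  proof (rule pi_eqI)
    show "x * e \<in> A1" by (intro inA1 e_A1 assms)
    show "\<pi> x 1 * e \<in> A1" by (rule inA1(6)[OF A_A1[OF pi_A[OF assms inA(1)]] e_A1])
    fix z assume z: "z \<in> A"
    then have "\<pi> x (1 * E z) = \<pi> x 1 * E z" using assms by (intro pi_right_linear inA E_in)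
    then show "\<pi> (x * e) z = \<pi> (\<pi> x 1 * e) z"
      using z assms by (simp add: pi_mult e_A1 A_A1 pi_A inA pi_e pi_left E_A)
  qed
qed

text \<open>
  A central \<open>z\<close> satisfies \<open>z * e = e * z * e = b * e\<close> with \<open>b \<in> B\<close>, and \<open>b\<close> is central in \<open>B\<close>, hence a scalar. Then \<open>z\<close> acts as this
  scalar on \<open>A e A\<close>, which contains \<open>1\<close>.
\<close>

theorem trivial_center_A1:
  assumes "trivial_center B" shows "trivial_center A1"
  unfolding trivial_center_def
proof (intro ballI impI)
  fix z assume z: "z \<in> A1" and c: "\<forall>x\<in>A1. z * x = x * z"
  obtain a where a: "a \<in> A" "z * e = a * e" using mult_e[OF z] by blast
  have "z * e = e * (z * e)" using c e_A1 e_idempotent by (metis mult.assoc)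
  also have "\<dots> = E a * e" using a e_compress by (simp add: mult.assoc)
  finally have ze: "z * e = E a * e" .
  have "E a * b = b * E a" if b: "b \<in> B" for b
  proof -
    have "E a * b * e = z * e * b" using ze e_commutes[OF b] by (metis mult.assoc)
    also have "\<dots> = b * (z * e)" using c A_A1[OF B_A[OF b]] e_commutes[OF b] by (metis mult.assoc)
    also have "\<dots> = b * E a * e" by (simp add: ze mult.assoc)
    finally have "(E a * b - b * E a) * e = 0" by (simp add: left_diff_distrib)
    moreover have "E a * b - b * E a \<in> A" by (intro inA E_A a B_A[OF b])
    ultimately have "E a * b - b * E a = 0" by (rule mult_e_inj[rotated])
    then show ?thesis by simp
  qed
  then obtain k where k: "E a = k *\<^sub>C 1"
    using assms a(1) E_in unfolding trivial_center_def by blast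
  have "z = (\<Sum>i<n. z * (l i * e * star (l i)))" using sum_e by (simp flip: sum_distrib_left)
  also have "\<dots> = (\<Sum>i<n. k *\<^sub>C (l i * e * star (l i)))"
  proof (intro sum.cong refl)
    fix i assume "i \<in> {..<n}"
    then have "z * l i = l i * z" using c A_A1 l_A by simp
    then have "z * (l i * e * star (l i)) = l i * (z * e) * star (l i)" by (metis mult.assoc)
    also have "\<dots> = k *\<^sub>C (l i * e * star (l i))"
      unfolding ze k by (simp add: mult_scaleC_left mult_scaleC_right)
    finally show "z * (l i * e * star (l i)) = k *\<^sub>C (l i * e * star (l i))" .
  qed
  also have "\<dots> = k *\<^sub>C 1" by (simp only: sum_e flip: scaleC_sum_right)
  finally show "\<exists>c. z = c *\<^sub>C 1" by blast
qed

end


section \<open>The minimal expectation of a basic construction\<close>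

text \<open>
  Write \<open>k = F e\<close>. The elements \<open>E.\<psi> (x * e)\<close> with \<open>x \<in> B' \<inter> A\<close> are the right multiplications by \<open>x\<close> and
  commute with \<open>A\<close>. Compressing the standard condition of \<open>F\<close> at such an element by \<open>e\<close> gives
  \<open>E (x * M) = s r E (x * k)\<close>, where \<open>M\<close> is the inverse of \<open>k\<close>; so \<open>M = s r k\<close> because \<open>E\<close> is
  faithful. Now \<open>k\<^sup>2\<close> is a scalar and \<open>k\<close>, being the image of a projection, is positive, so \<open>k\<close>
  is a scalar itself. Applying \<open>F\<close> to \<open>1 = (\<Sum>i<n. l i * e * star (l i))\<close> then gives \<open>1 = r k\<close>.
\<close>

theorem minimal_dual_expectation:
  assumes E: "standard_expectation B A E n l r" and bc: "basic_construction B A E n l A1 e"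
    and F: "standard_expectation A A1 F m \<mu> s"
  shows "F e = of_real (1 / r)" and "s = r"
proof -
  interpret E: standard_expectation B A E n l r by fact
  interpret bc: basic_construction B A E n l A1 e by fact
  interpret F: standard_expectation A A1 F m \<mu> s by fact
  note e = bc.e_A1
  have rs: "r > 0" "s > 0" using E.r_pos F.r_pos by auto
  define k where "k = F e"
  have kA: "k \<in> A" unfolding k_def by (intro F.E_in e)
  have sk: "star k = k" unfolding k_def using F.E_star[OF e] bc.e_selfadjoint by simp
  have kR: "k \<in> rel_commutant B A"
  proof -
    have "b * k = k * b" if b: "b \<in> B" for b
      unfolding k_def using F.E_left[OF E.B_A[OF b] e] F.E_right[OF E.B_A[OF b] e] bc.e_commutes[OF b] by simp
    then show ?thesis using kA by (simp add: rel_commutant_def)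
  qed
  have "\<exists>a. a \<in> A \<and> e * \<mu> j = e * a" if j: "j < m" for j
  proof -
    have "star (\<mu> j) \<in> A1" using j by (intro F.inA F.l_A)
    then obtain a where a: "a \<in> A" "star (\<mu> j) * e = a * e" by (rule bc.mult_e)
    then have "star (star (\<mu> j) * e) = star (a * e)" by simp
    then have "e * \<mu> j = e * star a" by (simp add: star_mult star_star bc.e_selfadjoint)
    moreover have "star a \<in> A" by (intro E.inA a(1))
    ultimately show ?thesis by blast
  qed
  then obtain a where a: "\<And>j. j < m \<Longrightarrow> a j \<in> A" "\<And>j. j < m \<Longrightarrow> e * \<mu> j = e * a j" by metis
  have a_star: "star (\<mu> j) * e = star (a j) * e" if j: "j < m" for j
  proof -
    have "star (e * \<mu> j) = star (e * a j)" using a(2)[OF j] by simp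
    then show ?thesis by (simp add: star_mult bc.e_selfadjoint)
  qed
  \<comment> \<open>Expanding \<open>e\<close> in the quasi-basis of \<open>F\<close> exhibits the inverse of \<open>k\<close>.\<close>
  define M where "M = (\<Sum>j<m. a j * star (a j))"
  have MA: "M \<in> A" unfolding M_def
    by (rule subalgebra_sum[OF E.subalgebra_A]) (use a(1) in \<open>auto intro: E.inA(6,9)\<close>)
  have sM: "star M = M" by (simp add: M_def star_sum star_mult star_star)
  have kM: "k * M = 1"
  proof -
    have "F (e * \<mu> j) = k * a j" if j: "j < m" for j
      unfolding a(2)[OF j] k_def by (rule F.E_right[OF a(1)[OF j] e])
    then have "e = (\<Sum>j<m. k * a j * star (\<mu> j))" using F.expand_right[OF e] by simp
    then have "e * e = (\<Sum>j<m. k * a j * star (\<mu> j)) * e" by simp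
    also have "\<dots> = (\<Sum>j<m. k * (a j * star (a j)) * e)"
      unfolding sum_distrib_right by (intro sum.cong refl) (simp add: a_star mult.assoc)
    also have "\<dots> = k * M * e" by (simp add: M_def sum_distrib_left sum_distrib_right)
    finally have "(k * M - 1) * e = 0" by (simp add: bc.e_idempotent left_diff_distrib)
    moreover have "k * M - 1 \<in> A" by (intro E.inA kA MA)
    ultimately have "k * M - 1 = 0" by (rule bc.mult_e_inj[rotated])
    then show ?thesis by simp
  qed
  have Mk: "M * k = 1"
  proof -
    have "star (k * M) = 1" using kM by simp
    then show ?thesis by (simp add: star_mult sk sM)
  qed
  have MR: "M \<in> rel_commutant B A"
  proof -
    have "b * M = M * b" if b: "b \<in> B" for b
    proof -
      have "b * M = M * (k * b) * M" using Mk by (simp add: mult.assoc[symmetric])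
      also have "\<dots> = M * b * (k * M)" using rel_commutant_commutes[OF kR b] by (metis mult.assoc)
      finally show ?thesis using kM by simp
    qed
    then show ?thesis using MA by (simp add: rel_commutant_def)
  qed
  have key: "E (x * M) = (s * r) *\<^sub>R E (x * k)" if x: "x \<in> rel_commutant B A" for x
  proof -
    have xA: "x \<in> A" using x by (simp add: rel_commutant_def)
    define y where "y = E.\<psi> (x * e)"
    have lA1: "l i \<in> A1" if "i < n" for i using bc.A_A1[OF E.l_A[OF that]] .
    have xe: "x * e \<in> A1" by (intro F.inA bc.A_A1 xA e)
    have term_A1: "l i * (x * e) * star (l i) \<in> A1" if "i < n" for i
      by (rule F.inA(6)[OF F.inA(6)[OF lA1[OF that] xe] F.inA(9)[OF lA1[OF that]]])
    have yA1: "y \<in> A1" unfolding y_def E.\<psi>_def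
      by (rule subalgebra_sum[OF F.subalgebra_A]) (use term_A1 in auto)
    have "b * (x * e) = x * e * b" if b: "b \<in> B" for b
      using rel_commutant_commutes[OF x b] bc.e_commutes[OF b] by (metis mult.assoc)
    then have yc: "c * y = y * c" if "c \<in> A" for c
      unfolding y_def using that by (rule E.psi_commutes)
    then have yR: "y \<in> rel_commutant A A1" using yA1 by (simp add: rel_commutant_def)
    have "F y = (\<Sum>i<n. F (l i * (x * e) * star (l i)))"
      unfolding y_def E.\<psi>_def using term_A1 by (intro F.E_sum) auto
    also have "\<dots> = (\<Sum>i<n. l i * (x * k) * star (l i))"
    proof (intro sum.cong refl)
      fix i assume "i \<in> {..<n}"
      then have "l i \<in> A" "star (l i) \<in> A" using E.l_A by (auto intro: E.inA(9))
      then show "F (l i * (x * e) * star (l i)) = l i * (x * k) * star (l i)"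
        using F.E_bimodule[OF _ _ xe] F.E_left[OF xA e] by (simp add: k_def)
    qed
    also have "\<dots> = r *\<^sub>R E (x * k)"
      using E.psi_eq[OF E.in_rel_commutant(6)[OF x kR]] by (simp add: E.\<psi>_def)
    finally have "F.\<psi> y = (s * r) *\<^sub>R E (x * k)" using F.psi_eq[OF yR] by simp
    moreover have "e * E (x * k) * e = E (x * k) * e"
      using bc.e_compress[of "E (x * k)"] xA kA by (simp add: E.E_A E.E_fix E.E_in E.inA)
    ultimately have 1: "e * F.\<psi> y * e = (s * r) *\<^sub>R E (x * k) * e" by simp
    \<comment> \<open>The same compression computed directly: the quasi-basis of \<open>F\<close> contributes \<open>M\<close>, and \<open>E_commute\<close> reassembles \<open>x\<close>.\<close>
    have "e * F.\<psi> y * e = (\<Sum>j<m. e * \<mu> j * y * (star (\<mu> j) * e))"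
      unfolding F.\<psi>_def sum_distrib_left sum_distrib_right by (simp add: mult.assoc)
    also have "\<dots> = (\<Sum>j<m. e * y * (a j * star (a j)) * e)"
    proof (intro sum.cong refl)
      fix j assume "j \<in> {..<m}"
      then have j: "j < m" by simp
      have "e * \<mu> j * y * (star (\<mu> j) * e) = e * (a j * y) * (star (a j) * e)"
        unfolding a(2)[OF j] a_star[OF j] by (simp add: mult.assoc)
      then show "e * \<mu> j * y * (star (\<mu> j) * e) = e * y * (a j * star (a j)) * e"
        unfolding yc[OF a(1)[OF j]] by (simp add: mult.assoc)
    qed
    also have "\<dots> = e * y * M * e" by (simp add: M_def sum_distrib_left sum_distrib_right)
    also have "\<dots> = (\<Sum>i<n. (e * (l i * x) * e) * (star (l i) * M) * e)"
      unfolding y_def E.\<psi>_def sum_distrib_left sum_distrib_right by (simp add: mult.assoc)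
    also have "\<dots> = (\<Sum>i<n. E (x * l i) * (e * (star (l i) * M) * e))"
    proof (intro sum.cong refl)
      fix i assume "i \<in> {..<n}"
      then have li: "l i \<in> A" using E.l_A by simp
      have "e * (l i * x) * e = E (x * l i) * e"
        using bc.e_compress[of "l i * x"] E.E_commute[OF x li] li xA by (simp add: E.inA)
      then show "(e * (l i * x) * e) * (star (l i) * M) * e = E (x * l i) * (e * (star (l i) * M) * e)"
        by (simp add: mult.assoc)
    qed
    also have "\<dots> = (\<Sum>i<n. E (E (x * l i) * star (l i) * M)) * e"
      unfolding sum_distrib_right
    proof (intro sum.cong refl)
      fix i assume "i \<in> {..<n}"
      then have li: "l i \<in> A" using E.l_A by simp
      have "e * (star (l i) * M) * e = E (star (l i) * M) * e"
        using li MA by (intro bc.e_compress E.inA)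
      moreover have "E (E (x * l i) * (star (l i) * M)) = E (x * l i) * E (star (l i) * M)"
        using li MA xA by (intro E.E_left E.E_in E.inA)
      ultimately show "E (x * l i) * (e * (star (l i) * M) * e) = E (E (x * l i) * star (l i) * M) * e"
        by (simp add: mult.assoc)
    qed
    also have "(\<Sum>i<n. E (E (x * l i) * star (l i) * M)) = E (\<Sum>i<n. E (x * l i) * star (l i) * M)"
      using E.l_A MA xA by (intro E.E_sum[symmetric] E.inA(6,9) E.E_A) auto
    also have "(\<Sum>i<n. E (x * l i) * star (l i) * M) = x * M"
      using E.expand_right[OF xA] by (simp flip: sum_distrib_right)
    finally have "(E (x * M) - (s * r) *\<^sub>R E (x * k)) * e = 0"
      using 1 by (simp add: left_diff_distrib)
    moreover have "E (x * M) - (s * r) *\<^sub>R E (x * k) \<in> A" by (intro E.inA E.E_A xA MA kA)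
    ultimately have "E (x * M) - (s * r) *\<^sub>R E (x * k) = 0" by (rule bc.mult_e_inj[rotated])
    then show ?thesis by simp
  qed
  have M: "M = (s * r) *\<^sub>R k"
  proof -
    define u where "u = M - (s * r) *\<^sub>R k"
    have uR: "u \<in> rel_commutant B A" unfolding u_def by (intro E.in_rel_commutant MR kR)
    then have uA: "u \<in> A" "star u \<in> A" by (auto simp: rel_commutant_def intro: E.inA(9))
    have "E (star u * M) = (s * r) *\<^sub>R E (star u * k)" by (intro key E.in_rel_commutant uR)
    moreover have "star u * u = star u * M - (s * r) *\<^sub>R (star u * k)" by (simp add: u_def right_diff_distrib)
    ultimately have "E (star u * u) = 0"
      using uA MA kA by (simp add: E.E_diff E.E_scaleR E.inA)
    then show ?thesis using E.E_faithful[OF uA(1)] by (simp add: u_def)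
  qed
  define q where "q = sqrt (s * r)"
  have q: "q > 0" "q * q = s * r" using rs by (simp_all add: q_def)
  have qk: "(q *\<^sub>R k) * (q *\<^sub>R k) = 1" using kM M q by simp
  \<comment> \<open>The spectral projection of \<open>k\<close> for the value \<open>-1/q\<close>; positivity of \<open>k\<close> makes it vanish.\<close>
  define p where "p = (1/2) *\<^sub>R (1 - q *\<^sub>R k)"
  have pA: "p \<in> A" unfolding p_def by (intro E.inA kA)
  have sp: "star p = p" by (simp add: p_def star_scaleR star_diff sk)
  have w: "(1 - w) * (1 - w) = 2 *\<^sub>R (1 - w)" "w * (1 - w) = - (1 - w)" if "w * w = 1" for w :: 'a
    using that by (simp_all add: left_diff_distrib right_diff_distrib scaleR_2)
  have pp: "p * p = p"
  proof -
    have "p * p = (1/4) *\<^sub>R ((1 - q *\<^sub>R k) * (1 - q *\<^sub>R k))" by (simp add: p_def)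
    then show ?thesis unfolding w(1)[OF qk] by (simp add: p_def)
  qed
  have kp: "q *\<^sub>R (k * p) = - p"
  proof -
    have "q *\<^sub>R (k * p) = (1/2) *\<^sub>R ((q *\<^sub>R k) * (1 - q *\<^sub>R k))" by (simp add: p_def)
    then show ?thesis unfolding w(2)[OF qk] p_def by (simp only: scaleR_minus_right)
  qed
  have "star (e * p) * (e * p) = p * e * p"
    using bc.e_idempotent by (simp add: star_mult sp bc.e_selfadjoint) (metis mult.assoc)
  then have "F (star (e * p) * (e * p)) = p * k * p"
    using F.E_bimodule[OF pA pA e] by (simp add: k_def)
  moreover have "e * p \<in> A1" by (intro F.inA e bc.A_A1 pA)
  ultimately have "psd (p * k * p)" using F.E_psd_square by metis
  then have "psd (q *\<^sub>R (p * k * p))" using q(1) by (intro psd_scaleR) auto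
  moreover have "q *\<^sub>R (p * k * p) = - p"
  proof -
    have "q *\<^sub>R (p * k * p) = p * (q *\<^sub>R (k * p))" by (simp add: mult.assoc)
    then show ?thesis unfolding kp using pp by simp
  qed
  moreover have "psd p" using psd_star_mult_self[of p] sp pp by simp
  ultimately have "p = 0" using psd_antisym by simp
  then have "q *\<^sub>R k = 1" by (simp add: p_def)
  then have "(1/q) *\<^sub>R (q *\<^sub>R k) = (1/q) *\<^sub>R 1" by simp
  then have k: "k = of_real (1/q)" using q(1) by (simp add: of_real_def)
  have "1 = F (\<Sum>i<n. l i * e * star (l i))" using bc.sum_e F.E_1 by simp
  also have "\<dots> = (\<Sum>i<n. F (l i * e * star (l i)))"
    using E.l_A by (intro F.E_sum F.inA(6,9) bc.A_A1 e) auto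
  also have "\<dots> = E.\<psi> k" unfolding E.\<psi>_def k_def
    using E.l_A e by (intro sum.cong refl F.E_bimodule E.inA(9)) auto
  also have "\<dots> = r *\<^sub>R E k" by (rule E.psi_eq[OF kR])
  also have "\<dots> = of_real (r / q)" unfolding k E.E_of_real by (simp add: of_real_def)
  finally have "of_real (r / q) = (of_real 1 :: 'a)" by simp
  then have "r / q = 1" unfolding of_real_eq_iff .
  then have rq: "r = q" using q(1) by simp
  show "F e = of_real (1 / r)" using k by (simp add: k_def rq)
  show "s = r" using q rs rq by simp
qed

section \<open>The trace\<close>

lemma scaleC_one_inj: "c *\<^sub>C 1 = (d *\<^sub>C 1 :: 'a::cstar_algebra) \<Longrightarrow> c = d"
proof -
  assume "c *\<^sub>C 1 = (d *\<^sub>C 1 :: 'a)"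
  then have "(c - d) *\<^sub>C (1::'a) = 0"
    using scaleC_add_left[of c "- d" "1::'a"] by (simp add: scaleC_minus_left)
  then have "cmod (c - d) = 0" by (metis norm_scaleC norm_zero norm_one mult.right_neutral)
  then show "c = d" by simp
qed

definition scalar_part :: "'a::cstar_algebra \<Rightarrow> complex" where
  "scalar_part x = (THE c. x = c *\<^sub>C 1)"

lemma scalar_part_scaleC [simp]: "scalar_part (c *\<^sub>C 1 :: 'a::cstar_algebra) = c"
  unfolding scalar_part_def by (rule the_equality) (auto dest: scaleC_one_inj)

lemma standard_expectation_trace:
  assumes "standard_expectation B A E n l r" and tB: "trivial_center B"
  shows "faithful_tracial_state (rel_commutant B A) (\<lambda>x. scalar_part (E x))"
proof -
  interpret standard_expectation B A E n l r by fact
  have A: "x \<in> A" if "x \<in> rel_commutant B A" for x using that by (simp add: rel_commutant_def)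
  have sc: "E x = scalar_part (E x) *\<^sub>C 1" if x: "x \<in> rel_commutant B A" for x
    by (rule E_rel_commutant_scalar[OF tB x]) simp
  have nonneg: "scalar_part (E x) \<in> \<real>\<^sub>\<ge>\<^sub>0" and pos: "scalar_part (E x) = 0 \<longrightarrow> x = 0"
    if x: "x \<in> positives (rel_commutant B A)" for x
  proof -
    obtain y where y: "y \<in> rel_commutant B A" "x = star y * y" using x by (auto simp: positives_def)
    have xR: "x \<in> rel_commutant B A" unfolding y(2) by (intro in_rel_commutant y)
    have p: "psd (E x)" unfolding y(2) by (rule E_psd_square[OF A[OF y(1)]])
    define c where "c = scalar_part (E x)"
    have c: "E x = c *\<^sub>C 1" using sc[OF xR] by (simp add: c_def)
    then have cr: "E x = of_real (Re c)" using selfadjoint_scalar[of c] psd_selfadjoint[OF p] by simp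
    then have "Re c \<ge> 0" using p psd_of_real by metis
    moreover have "c = complex_of_real (Re c)"
      using scaleC_one_inj[where 'a = 'a] c cr unfolding of_real_conv_scaleC by metis
    ultimately show "scalar_part (E x) \<in> \<real>\<^sub>\<ge>\<^sub>0"
      unfolding c_def[symmetric] by (metis nonneg_Reals_of_real_iff)
    show "scalar_part (E x) = 0 \<longrightarrow> x = 0"
      using sc[OF xR] E_faithful[OF A[OF y(1)]] y(2) by auto
  qed
  show ?thesis unfolding faithful_tracial_state_def
  proof (intro conjI ballI allI)
    fix x assume x: "x \<in> rel_commutant B A"
    show "scalar_part (E (x + y)) = scalar_part (E x) + scalar_part (E y)"
      if y: "y \<in> rel_commutant B A" for y
    proof -
      have "E (x + y) = (scalar_part (E x) + scalar_part (E y)) *\<^sub>C 1"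
        using sc[OF x] sc[OF y] A[OF x] A[OF y] by (simp add: E_add scaleC_add_left)
      then show ?thesis by simp
    qed
    show "scalar_part (E (c *\<^sub>C x)) = c * scalar_part (E x)" for c
    proof -
      have "E (c *\<^sub>C x) = c *\<^sub>C (scalar_part (E x) *\<^sub>C 1)"
        using sc[OF x] A[OF x] by (simp add: E_scaleC)
      then show ?thesis by (simp add: scaleC_scaleC)
    qed
    show "scalar_part (E (x * y)) = scalar_part (E (y * x))" if y: "y \<in> rel_commutant B A" for y
      using E_commute[OF x A[OF y]] by simp
  next
    show "scalar_part (E 1) = 1" using scalar_part_scaleC[of 1, where 'a = 'a] by simp
  qed (use nonneg pos in auto)
qed

lemma minimal_index_eq:
  assumes min: "minimal_expectation B A (E :: 'a::cstar_algebra \<Rightarrow> 'a)" and ind: "Ind A E = of_real r"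
  shows "minimal_index B A = r"
proof -
  have *: "\<rho> \<le> \<rho>'"
    if "minimal_expectation B A F" "Ind A F = of_real \<rho>" "minimal_expectation B A F'" "Ind A F' = of_real \<rho>'"
    for F F' :: "'a \<Rightarrow> 'a" and \<rho> \<rho>'
    using that unfolding minimal_expectation_def has_scalar_index_def by auto
  show ?thesis unfolding minimal_index_def
    by (rule the_equality) (use min ind * in \<open>blast intro: order.antisym\<close>)+
qed

text \<open>
  The levels of the tower are treated by induction. Each basic construction passes trivial centers
  and the constant \<open>r = 1 / \<tau>\<close> on to the next level; the trace at level \<open>k\<close> comes from the composite \<open>\<Phi> k\<close>.
\<close>

theorem proposition2p21:
  fixes B :: "'a::cstar_algebra set"
    and A :: "nat \<Rightarrow> 'a set"
    and E :: "nat \<Rightarrow> 'a \<Rightarrow> 'a"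
    and e :: "nat \<Rightarrow> 'a"
    and \<tau> :: real
  assumes "simple_cstar B" and "simple_cstar (A 0)" and "B \<subseteq> A 0"
    and "\<exists>F. finite_index_expectation B (A 0) F"
    and "\<tau> = inverse (minimal_index B (A 0))"
    and "basic_construction_tower B A E e"
  shows "\<exists>tr :: nat \<Rightarrow> 'a \<Rightarrow> complex.
    (\<forall>k. faithful_tracial_state (rel_commutant B (A k)) (tr k)) \<and>
    (\<forall>k\<ge>1. (\<forall>x \<in> rel_commutant B (A (k - 1)).
                tr k (x * e k) = complex_of_real \<tau> * tr k x) \<and>
            (\<forall>x \<in> rel_commutant B (A (k - 1)). tr k x = tr (k - 1) x))"
proof -
  \<comment> \<open>\<open>P k\<close> is the algebra just below \<open>A k\<close>.\<close>
  define P where "P = case_nat B A"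
  have P0: "P 0 = B" and PS: "P (Suc k) = A k" for k by (simp_all add: P_def)
  have min: "minimal_expectation (P k) (A k) (E k)"
    and bc: "is_basic_construction (P k) (A k) (E k) (A (Suc k)) (e (Suc k))" for k
    using assms(6) unfolding basic_construction_tower_def P_def by blast+
  define good where "good k \<longleftrightarrow> cstar_subalgebra (P k) \<and> cstar_subalgebra (A k) \<and> P k \<subseteq> A k \<and>
      trivial_center (P k) \<and> trivial_center (A k)" for k
  have std: "\<exists>n l r. standard_expectation (P k) (A k) (E k) n l r \<and> Ind (A k) (E k) = of_real r"
    if "good k" for k
    using that min[of k] unfolding good_def by (metis minimal_imp_standard)
  have bcl: "basic_construction (P k) (A k) (E k) n l (A (Suc k)) (e (Suc k))"
    if "standard_expectation (P k) (A k) (E k) n l r" for k n l r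
  proof -
    interpret standard_expectation "P k" "A k" "E k" n l r by fact
    show ?thesis by unfold_locales (rule bc)
  qed
  have good: "good k" for k
  proof (induction k)
    case 0
    have "cstar_subalgebra B" "cstar_subalgebra (A 0)" using assms(1,2) by (auto simp: simple_cstar_def)
    then show ?case
      using assms(3) simple_trivial_center[OF assms(1)] simple_trivial_center[OF assms(2)]
      by (simp add: good_def P0)
  next
    case (Suc k)
    then obtain n l r where "standard_expectation (P k) (A k) (E k) n l r" using std by blast
    from bcl[OF this] interpret basic_construction "P k" "A k" "E k" n l "A (Suc k)" "e (Suc k)" .
    show ?case using Suc subalgebra_A subalgebra_A1 A_A1 trivial_center_A1
      unfolding good_def PS by blast
  qed
  obtain r where r: "\<exists>n l. standard_expectation (P 0) (A 0) (E 0) n l r" "Ind (A 0) (E 0) = of_real r"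
    using std[OF good[of 0]] by blast
  have \<tau>: "\<tau> = 1 / r"
    using assms(5) minimal_index_eq[OF min[of 0] r(2)] by (simp add: P0 divide_inverse)
  have level: "\<exists>n l. standard_expectation (P k) (A k) (E k) n l r" for k
  proof (induction k)
    case (Suc k)
    then obtain n l where s: "standard_expectation (P k) (A k) (E k) n l r" by blast
    obtain m \<mu> r' where s': "standard_expectation (A k) (A (Suc k)) (E (Suc k)) m \<mu> r'"
      using std[OF good[of "Suc k"]] unfolding PS by blast
    have "r' = r" by (rule minimal_dual_expectation(2)[OF s bcl[OF s] s'])
    then show ?case using s' unfolding PS by blast
  qed (rule r(1))
  have Ee: "E (Suc k) (e (Suc k)) = of_real \<tau>" for k
  proof -
    obtain n l where s: "standard_expectation (P k) (A k) (E k) n l r" using level by blast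
    obtain m \<mu> where s': "standard_expectation (A k) (A (Suc k)) (E (Suc k)) m \<mu> r"
      using level[of "Suc k"] unfolding PS by blast
    show ?thesis unfolding \<tau> by (rule minimal_dual_expectation(1)[OF s bcl[OF s] s'])
  qed
  define \<Phi> where "\<Phi> = rec_nat (E 0) (\<lambda>k G. G \<circ> E (Suc k))"
  have \<Phi>0: "\<Phi> 0 = E 0" and \<Phi>S: "\<Phi> (Suc k) = \<Phi> k \<circ> E (Suc k)" for k by (simp_all add: \<Phi>_def)
  have comp: "\<exists>n l R. standard_expectation B (A k) (\<Phi> k) n l R" for k
  proof (induction k)
    case 0
    show ?case using level[of 0] by (auto simp: \<Phi>0 P0)
  next
    case (Suc k)
    then obtain n l R where s: "standard_expectation B (A k) (\<Phi> k) n l R" by blast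
    obtain m \<mu> where s': "standard_expectation (A k) (A (Suc k)) (E (Suc k)) m \<mu> r"
      using level[of "Suc k"] unfolding PS by blast
    show ?case unfolding \<Phi>S by (rule standard_expectation_compose[OF s s']) blast
  qed
  define tr where "tr k x = scalar_part (\<Phi> k x)" for k x
  have tB: "trivial_center B" using good[of 0] by (simp add: good_def P0)
  have "faithful_tracial_state (rel_commutant B (A k)) (tr k)" for k
    using comp[of k] standard_expectation_trace[OF _ tB] unfolding tr_def by blast
  moreover have "tr k (x * e k) = complex_of_real \<tau> * tr k x" and "tr k x = tr (k - 1) x"
    if "k \<ge> 1" and x: "x \<in> rel_commutant B (A (k - 1))" for k x
  proof -
    obtain j where k: "k = Suc j" using \<open>k \<ge> 1\<close> by (cases k) auto
    have xR: "x \<in> rel_commutant B (A j)" and xA: "x \<in> A j"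
      using x by (auto simp: k rel_commutant_def)
    obtain n l where s: "standard_expectation (P j) (A j) (E j) n l r" using level by blast
    interpret bc: basic_construction "P j" "A j" "E j" n l "A (Suc j)" "e (Suc j)" by (rule bcl[OF s])
    obtain m \<mu> where s': "standard_expectation (A j) (A (Suc j)) (E (Suc j)) m \<mu> r"
      using level[of "Suc j"] unfolding PS by blast
    interpret F: standard_expectation "A j" "A (Suc j)" "E (Suc j)" m \<mu> r by (rule s')
    obtain n' l' R where "standard_expectation B (A j) (\<Phi> j) n' l' R" using comp by blast
    then interpret G: standard_expectation B "A j" "\<Phi> j" n' l' R .
    have down: "\<Phi> k x = \<Phi> j x" using xA by (simp add: k \<Phi>S F.E_fix)
    then show "tr k x = tr (k - 1) x" by (simp add: tr_def k)
    have "E (Suc j) (x * e (Suc j)) = \<tau> *\<^sub>R x"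
      using F.E_left[OF xA bc.e_A1] by (simp add: Ee of_real_def)
    then have "\<Phi> k (x * e k) = complex_of_real \<tau> *\<^sub>C \<Phi> k x"
      using G.E_scaleC[OF xA] unfolding down by (simp add: k \<Phi>S flip: scaleC_of_real)
    moreover obtain c where "\<Phi> j x = c *\<^sub>C 1" using G.E_rel_commutant_scalar[OF tB xR] by blast
    ultimately show "tr k (x * e k) = complex_of_real \<tau> * tr k x"
      by (simp add: tr_def down scaleC_scaleC)
  qed
  ultimately show ?thesis by blast
qed

end
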